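(* Let $(a_n)_{n\in\mathbb{N}}$ and $(b_{n,j})_{n,j\in\mathbb{N}}$ be real numbers with $a_n\ge 0$ for all $n$, $b_{n,j}\ge 0$ for all $n,j$, and $b_{n,j}=0$ whenever $n\ge j$. Let $w$ be a weight such that $w_n\ge n$ for all $n\in\mathbb{N}$ and such that there exists $\kappa\in(0,1]$ with $\sum_{n=1}^{j-1}w_nb_{n,j}\le\kappa w_j$ for all $j=2,3,\ldots$. Let $\mathring{u}\in\ell_w^1$. Then $u(t)=S^{(w)}(t)\mathring{u}$ satisfies the system $$u_n'(t)=-a_nu_n(t)+\sum_{j=n+1}^\infty a_jb_{n,j}u_j(t),\qquad u_n(0)=\mathring{u}_n,\qquad n=1,2,\ldots,$$ where the differential equations hold for almost all $t\ge0$. Moreover, if $\mathring{u}\ge0$, then $u(t)\ge0$ for $t\ge0$.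
   Context: $\mathbb{N}=\{1,2,\ldots\}$. A weight is a sequence $w=(w_n)_{n=1}^\infty$ of strictly positive reals, and $\ell_w^1$ is the Banach space of real sequences $f=(f_n)_{n=1}^\infty$ with $\|f\|_w=\sum_{n=1}^\infty w_n|f_n|<\infty$, ordered componentwise. Operators: $A^{(w)}f=(-a_nf_n)_{n=1}^\infty$ with $\mathcal{D}(A^{(w)})=\{f\in\ell_w^1:(a_nf_n)_n\in\ell_w^1\}$; $B^{(w)}f=\bigl(\sum_{j=n+1}^\infty a_jb_{n,j}f_j\bigr)_{n=1}^\infty$ with $\mathcal{D}(B^{(w)})$ the set of $f\in\ell_w^1$ for which this sequence is well defined and lies in $\ell_w^1$. Under the stated hypotheses on $a_n,b_{n,j},w$, the closure $G^{(w)}=\overline{A^{(w)}+B^{(w)}}$ generates a substochastic $C_0$-semigroup on $\ell_w^1$ (positive, and contractive on the positive cone), denoted $(S^{(w)}(t))_{t\ge0}$. The components of $u(t)$ are written $u(t)=(u_n(t))_{n=1}^\infty$. *)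

theory Defs
  imports "HOL-Analysis.Analysis"
begin

text \<open>
  Sequences are indexed by the positive integers.  A sequence \<open>(f_n)\<close>, \<open>n \<ge> 1\<close>, is a function
  on \<^typ>\<open>nat\<close>; elements of the sequence spaces take the dummy value \<open>0\<close> at index \<open>0\<close>, so that a
  sequence has exactly one representative and sums over \<open>n \<ge> 1\<close> may be written over all \<open>n\<close>.
  The values of weights and coefficients at index \<open>0\<close> are never used.
\<close>

type_synonym seq = "nat \<Rightarrow> real"

definition ell1 :: "seq \<Rightarrow> seq set" where
  "ell1 w = {f. f 0 = 0 \<and> summable (\<lambda>n. w n * \<bar>f n\<bar>)}"

definition wnorm :: "seq \<Rightarrow> seq \<Rightarrow> real" where
  "wnorm w f = (\<Sum>n. w n * \<bar>f n\<bar>)"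

text \<open>
  Unbounded operators are represented by their graphs: \<open>(f, g) \<in> T\<close> means that \<open>f\<close> lies in the
  domain of \<open>T\<close> and \<open>T f = g\<close>.
\<close>

definition op_A :: "seq \<Rightarrow> seq \<Rightarrow> (seq \<times> seq) set" where
  "op_A w a = {(f, \<lambda>n. - a n * f n) | f. f \<in> ell1 w \<and> (\<lambda>n. a n * f n) \<in> ell1 w}"

text \<open>
  The inner series run over \<open>j = n + 1 + k\<close>, \<open>k \<ge> 0\<close>, and are only required to converge in the
  ordinary sense.
\<close>

definition B_seq :: "seq \<Rightarrow> (nat \<Rightarrow> nat \<Rightarrow> real) \<Rightarrow> seq \<Rightarrow> seq" where
  "B_seq a b f = (\<lambda>n. if n = 0 then 0
     else (\<Sum>k. a (n + 1 + k) * b n (n + 1 + k) * f (n + 1 + k)))"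

definition op_B :: "seq \<Rightarrow> seq \<Rightarrow> (nat \<Rightarrow> nat \<Rightarrow> real) \<Rightarrow> (seq \<times> seq) set" where
  "op_B w a b = {(f, B_seq a b f) | f. f \<in> ell1 w
     \<and> (\<forall>n\<ge>1. summable (\<lambda>k. a (n + 1 + k) * b n (n + 1 + k) * f (n + 1 + k)))
     \<and> B_seq a b f \<in> ell1 w}"

definition op_sum :: "(seq \<times> seq) set \<Rightarrow> (seq \<times> seq) set \<Rightarrow> (seq \<times> seq) set" where
  "op_sum T U = {(f, \<lambda>n. g n + h n) | f g h. (f, g) \<in> T \<and> (f, h) \<in> U}"

definition op_closure :: "seq \<Rightarrow> (seq \<times> seq) set \<Rightarrow> (seq \<times> seq) set" where
  "op_closure w T = {(f, g). f \<in> ell1 w \<and> g \<in> ell1 w \<and>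
     (\<exists>F G. (\<forall>k::nat. (F k, G k) \<in> T)
        \<and> (\<lambda>k. wnorm w (\<lambda>n. F k n - f n)) \<longlonglongrightarrow> 0
        \<and> (\<lambda>k. wnorm w (\<lambda>n. G k n - g n)) \<longlonglongrightarrow> 0)}"

definition bounded_op :: "seq \<Rightarrow> (seq \<Rightarrow> seq) \<Rightarrow> bool" where
  "bounded_op w T \<longleftrightarrow>
     (\<forall>f\<in>ell1 w. T f \<in> ell1 w)
   \<and> (\<forall>f\<in>ell1 w. \<forall>g\<in>ell1 w. T (\<lambda>n. f n + g n) = (\<lambda>n. T f n + T g n))
   \<and> (\<forall>c. \<forall>f\<in>ell1 w. T (\<lambda>n. c * f n) = (\<lambda>n. c * T f n))
   \<and> (\<exists>C. \<forall>f\<in>ell1 w. wnorm w (T f) \<le> C * wnorm w f)"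

definition C0_semigroup :: "seq \<Rightarrow> (real \<Rightarrow> seq \<Rightarrow> seq) \<Rightarrow> bool" where
  "C0_semigroup w S \<longleftrightarrow>
     (\<forall>t\<ge>0. bounded_op w (S t))
   \<and> (\<forall>f\<in>ell1 w. S 0 f = f)
   \<and> (\<forall>s\<ge>0. \<forall>t\<ge>0. \<forall>f\<in>ell1 w. S (s + t) f = S s (S t f))
   \<and> (\<forall>f\<in>ell1 w. ((\<lambda>t. wnorm w (\<lambda>n. S t f n - f n)) \<longlongrightarrow> 0) (at_right 0))"

definition generator :: "seq \<Rightarrow> (real \<Rightarrow> seq \<Rightarrow> seq) \<Rightarrow> (seq \<times> seq) set" where
  "generator w S = {(f, g). f \<in> ell1 w \<and> g \<in> ell1 w \<and>
     ((\<lambda>t. wnorm w (\<lambda>n. (S t f n - f n) / t - g n)) \<longlongrightarrow> 0) (at_right 0)}"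

definition op_G :: "seq \<Rightarrow> seq \<Rightarrow> (nat \<Rightarrow> nat \<Rightarrow> real) \<Rightarrow> (seq \<times> seq) set" where
  "op_G w a b = op_closure w (op_sum (op_A w a) (op_B w a b))"

text \<open>
  A \<open>C\<^sub>0\<close>-semigroup is determined by its generator, so the choice below is unique as far as
  \<open>S t f\<close> with \<open>t \<ge> 0\<close> and \<open>f \<in> ell1 w\<close> is concerned.  Positivity and contractivity are not built
  into the choice.
\<close>

definition frag_semigroup ::
    "seq \<Rightarrow> seq \<Rightarrow> (nat \<Rightarrow> nat \<Rightarrow> real) \<Rightarrow> real \<Rightarrow> seq \<Rightarrow> seq" where
  "frag_semigroup w a b = (SOME S. C0_semigroup w S \<and> generator w S = op_G w a b)"

end

theory Submission
  imports Defs
begin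

text \<open>
  The matrix of \<open>A + B\<close> is upper triangular, so sequences supported in \<open>{1..N}\<close> are invariant and the
  evolution on them is a finite linear system of ordinary differential equations.  Its solutions are
  positive, and \<open>\<Sum>\<^sub>n w\<^sub>n u\<^sub>n\<close> decreases along positive solutions because the weighted column sums are
  nonpositive.  The solutions started at the basis vectors form a kernel that defines a contraction
  semigroup on the whole space.  The finitely supported sequences are a core both for its generator
  (\<open>1 - (A + B)\<close> is invertible on them, and generators of contraction semigroups are dissipative) and for
  the closure of \<open>A + B\<close>; hence the two operators agree.  A semigroup with this generator is unique.

  For \<open>u\<^sub>0 \<ge> 0\<close> the solutions started at the truncations of \<open>u\<^sub>0\<close> increase to \<open>u\<close>.  After multiplication by
  the integrating factor \<open>exp (a\<^sub>n t)\<close> the \<open>n\<close>-th components are increasing limits of \<open>C\<^sup>1\<close> functions with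
  nonnegative, increasing derivatives, which may be differentiated termwise almost everywhere.  A general
  \<open>u\<^sub>0\<close> is split into its positive and negative part.
\<close>

section \<open>Weighted sequence spaces\<close>

text \<open>The semigroup picked by \<open>frag_semigroup\<close> is known only through its
  generator, not as a contraction semigroup. Uniqueness must therefore cover every C0-semigroup, and
  differentiating \<open>S (t - s)\<close> in \<open>s\<close> needs operator bounds that are
  locally uniform in time. Strong continuity yields them only through the uniform boundedness
  principle; this is why a gliding hump appears. The other estimates rest on absolutely convergent
  series of columns: \<open>w j * \<bar>f j\<bar>\<close> bounds the \<open>j\<close>-th term of the
  kernel series, and twice \<open>w j * \<bar>a j * f j\<bar>\<close> bounds the \<open>j\<close>-th
  column of A + B applied to \<open>f\<close>. Thus A dominates B, and truncations converge in the
  graph norm. The equations are claimed only almost everywhere because an arbitrary initial value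
  need not lie in the domain of the generator: the gain series is then not controlled by the norm of
  u(t), the \<open>a j\<close> being possibly unbounded. The integrating factor is needed because
  the full derivative has no sign, while the gain term alone is nonnegative and grows with the
  truncation, so that monotone convergence applies.\<close>

locale ell1_weight =
  fixes w :: seq
  assumes weight_pos: "1 \<le> n \<Longrightarrow> 0 < w n"
begin

lemma ell1_zero_index: "f \<in> ell1 w \<Longrightarrow> f 0 = 0"
  by (simp add: ell1_def)

lemma ell1_summable: "f \<in> ell1 w \<Longrightarrow> summable (\<lambda>n. w n * \<bar>f n\<bar>)"
  by (simp add: ell1_def)

lemma weight_term_nonneg: "f 0 = 0 \<Longrightarrow> 0 \<le> w n * \<bar>f n\<bar>"
  using weight_pos[of n] by (cases n) auto

text \<open>The terms are nonnegative, so one bound on the partial sums gives membership and the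
  norm estimate together.\<close>

lemma ell1I_bounded_sums:
  assumes "f 0 = 0" and le: "\<And>M. (\<Sum>n\<le>M. w n * \<bar>f n\<bar>) \<le> C"
  shows "f \<in> ell1 w" "wnorm w f \<le> C"
proof -
  have *: "summable (\<lambda>n. w n * \<bar>f n\<bar>)"
  proof (rule summableI_nonneg_bounded)
    show "(\<Sum>i<n. w i * \<bar>f i\<bar>) \<le> C" for n
      by (rule order_trans[OF sum_mono2 le[of n]]) (auto simp: weight_term_nonneg assms)
  qed (simp add: weight_term_nonneg assms)
  then show "f \<in> ell1 w" using assms by (simp add: ell1_def)
  show "wnorm w f \<le> C"
    unfolding wnorm_def using * le
    by (intro LIMSEQ_le_const2[OF summable_LIMSEQ'[OF *]]) auto
qed

lemma partial_sum_le_wnorm: "f \<in> ell1 w \<Longrightarrow> finite I \<Longrightarrow> (\<Sum>n\<in>I. w n * \<bar>f n\<bar>) \<le> wnorm w f"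
  unfolding wnorm_def
  by (rule sum_le_suminf) (auto simp: ell1_summable weight_term_nonneg ell1_zero_index)

lemma wnorm_nonneg: "f \<in> ell1 w \<Longrightarrow> 0 \<le> wnorm w f"
  unfolding wnorm_def
  by (rule suminf_nonneg) (auto simp: ell1_summable weight_term_nonneg ell1_zero_index)

lemma wnorm_coord: "f \<in> ell1 w \<Longrightarrow> w n * \<bar>f n\<bar> \<le> wnorm w f"
  using partial_sum_le_wnorm[of f "{n}"] by simp

lemma coord_le_wnorm: "f \<in> ell1 w \<Longrightarrow> 1 \<le> n \<Longrightarrow> \<bar>f n\<bar> \<le> wnorm w f / w n"
  using wnorm_coord[of f n] weight_pos[of n] by (simp add: field_simps)

lemma coord_le: "f \<in> ell1 w \<Longrightarrow> wnorm w f \<le> C \<Longrightarrow> 1 \<le> n \<Longrightarrow> \<bar>f n\<bar> \<le> C / w n"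
  using coord_le_wnorm[of f n] weight_pos[of n] by (simp add: field_simps)

lemma ell1_zero [simp]: "(\<lambda>n. 0) \<in> ell1 w"
  by (simp add: ell1_def)

lemma wnorm_zero [simp]: "wnorm w (\<lambda>n. 0) = 0"
  by (simp add: wnorm_def)

lemma
  assumes "f \<in> ell1 w"
  shows ell1_scale: "(\<lambda>n. c * f n) \<in> ell1 w"
    and wnorm_scale: "wnorm w (\<lambda>n. c * f n) = \<bar>c\<bar> * wnorm w f"
proof -
  have eq: "(\<lambda>n. w n * \<bar>c * f n\<bar>) = (\<lambda>n. \<bar>c\<bar> * (w n * \<bar>f n\<bar>))"
    by (simp add: abs_mult algebra_simps)
  show "(\<lambda>n. c * f n) \<in> ell1 w"
    using assms by (simp add: ell1_def eq summable_mult)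
  show "wnorm w (\<lambda>n. c * f n) = \<bar>c\<bar> * wnorm w f"
    using assms by (simp add: ell1_def wnorm_def eq suminf_mult)
qed

lemma
  assumes "f \<in> ell1 w" "g \<in> ell1 w"
  shows ell1_add: "(\<lambda>n. f n + g n) \<in> ell1 w"
    and wnorm_add: "wnorm w (\<lambda>n. f n + g n) \<le> wnorm w f + wnorm w g"
proof -
  have "(\<Sum>n\<le>M. w n * \<bar>f n + g n\<bar>) \<le> wnorm w f + wnorm w g" for M
  proof -
    have "w n * \<bar>f n + g n\<bar> \<le> w n * \<bar>f n\<bar> + w n * \<bar>g n\<bar>" for n
    proof (cases "n = 0")
      case False
      then show ?thesis
        using weight_pos[of n] mult_left_mono[OF abs_triangle_ineq[of "f n" "g n"], of "w n"]
        by (simp add: distrib_left)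
    qed (use assms in \<open>simp add: ell1_def\<close>)
    then have "(\<Sum>n\<le>M. w n * \<bar>f n + g n\<bar>) \<le> (\<Sum>n\<le>M. w n * \<bar>f n\<bar> + w n * \<bar>g n\<bar>)"
      by (intro sum_mono)
    also have "\<dots> \<le> wnorm w f + wnorm w g"
      unfolding sum.distrib by (intro add_mono partial_sum_le_wnorm assms) auto
    finally show ?thesis .
  qed
  then show "(\<lambda>n. f n + g n) \<in> ell1 w" "wnorm w (\<lambda>n. f n + g n) \<le> wnorm w f + wnorm w g"
    using assms by (auto intro!: ell1I_bounded_sums simp: ell1_zero_index)
qed

lemma
  assumes "f \<in> ell1 w" "g \<in> ell1 w"
  shows ell1_diff: "(\<lambda>n. f n - g n) \<in> ell1 w"
    and wnorm_diff: "wnorm w (\<lambda>n. f n - g n) \<le> wnorm w f + wnorm w g"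
  using ell1_add[OF assms(1) ell1_scale[OF assms(2), of "-1"]]
    wnorm_add[OF assms(1) ell1_scale[OF assms(2), of "-1"]]
    wnorm_scale[OF assms(2), of "-1"]
  by simp_all

lemma wnorm_minus_commute: "wnorm w (\<lambda>n. f n - g n) = wnorm w (\<lambda>n. g n - f n)"
  by (simp add: wnorm_def abs_minus_commute)

lemma wnorm_triangle:
  assumes "f \<in> ell1 w" "g \<in> ell1 w" "h \<in> ell1 w"
  shows "wnorm w (\<lambda>n. f n - h n) \<le> wnorm w (\<lambda>n. f n - g n) + wnorm w (\<lambda>n. g n - h n)"
  using wnorm_add[OF ell1_diff[OF assms(1,2)] ell1_diff[OF assms(2,3)]] by simp

lemma wnorm_reverse_triangle:
  assumes "f \<in> ell1 w" "g \<in> ell1 w"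
  shows "wnorm w f - wnorm w g \<le> wnorm w (\<lambda>n. f n - g n)"
  using wnorm_add[OF ell1_diff[OF assms(1,2)] assms(2)] by simp

lemma ell1_eqI:
  assumes "f \<in> ell1 w" "g \<in> ell1 w" "wnorm w (\<lambda>n. f n - g n) \<le> 0"
  shows "f = g"
proof
  fix n
  show "f n = g n"
  proof (cases "n = 0")
    case False
    have "w n * \<bar>f n - g n\<bar> \<le> 0"
      using wnorm_coord[OF ell1_diff[OF assms(1,2)], of n] assms(3) by simp
    then show ?thesis using False weight_pos[of n] by (simp add: mult_le_0_iff)
  qed (use assms in \<open>simp add: ell1_def\<close>)
qed

text \<open>Completeness in the form used later: an absolutely convergent series may be summed
  coordinatewise. The norm bound is checked on finitely many coordinates, where exchanging the two
  summations is harmless.\<close>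

lemma ell1_series:
  fixes F :: "nat \<Rightarrow> seq"
  assumes F: "\<And>j. F j \<in> ell1 w" and le: "\<And>j. wnorm w (F j) \<le> c j" and c: "summable c"
  shows "summable (\<lambda>j. F j i)"
    and "(\<lambda>i. \<Sum>j. F j i) \<in> ell1 w"
    and "wnorm w (\<lambda>i. \<Sum>j. F j i) \<le> suminf c"
proof -
  have abs_summable: "summable (\<lambda>j. \<bar>F j i\<bar>)" for i
  proof (cases "i = 0")
    case False
    have "\<bar>F j i\<bar> \<le> c j / w i" for j
      using coord_le[OF F le] False by simp
    then show ?thesis
      by (intro summable_comparison_test'[OF summable_divide[OF c, of "w i"], of 0]) simp
  qed (use F in \<open>simp add: ell1_def\<close>)
  then show "summable (\<lambda>j. F j i)" by (rule summable_rabs_cancel)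
  have zero: "(\<Sum>j. F j 0) = 0" using F by (simp add: ell1_def)
  have sums: "(\<Sum>i\<le>M. w i * \<bar>\<Sum>j. F j i\<bar>) \<le> suminf c" for M
  proof -
    have "w i * \<bar>\<Sum>j. F j i\<bar> \<le> w i * (\<Sum>j. \<bar>F j i\<bar>)" for i
    proof (cases "i = 0")
      case False
      then show ?thesis
        using weight_pos[of i] summable_rabs[OF abs_summable[of i]] by (intro mult_left_mono) auto
    qed (use F in \<open>simp add: ell1_def\<close>)
    then have "(\<Sum>i\<le>M. w i * \<bar>\<Sum>j. F j i\<bar>) \<le> (\<Sum>i\<le>M. w i * (\<Sum>j. \<bar>F j i\<bar>))"
      by (intro sum_mono)
    also have "\<dots> = (\<Sum>j. \<Sum>i\<le>M. w i * \<bar>F j i\<bar>)"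
      using abs_summable by (simp add: suminf_sum summable_mult suminf_mult)
    also have "\<dots> \<le> suminf c"
    proof (rule suminf_le)
      show "(\<Sum>i\<le>M. w i * \<bar>F j i\<bar>) \<le> c j" for j
        using partial_sum_le_wnorm[OF F[of j], of "{..M}"] le[of j] by simp
      show "summable (\<lambda>j. \<Sum>i\<le>M. w i * \<bar>F j i\<bar>)"
        using abs_summable by (intro summable_sum summable_mult)
    qed (rule c)
    finally show ?thesis .
  qed
  show "(\<lambda>i. \<Sum>j. F j i) \<in> ell1 w" "wnorm w (\<lambda>i. \<Sum>j. F j i) \<le> suminf c"
    using ell1I_bounded_sums[of "\<lambda>i. \<Sum>j. F j i", OF zero sums] by auto
qed

section \<open>Truncations, unit vectors and finitely supported sequences\<close>

definition trunc :: "nat \<Rightarrow> seq \<Rightarrow> seq" where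
  "trunc N f = (\<lambda>n. if n \<le> N then f n else 0)"

text \<open>Setting \<open>basis 0 = 0\<close> lets finite expansions run over \<open>j \<le> N\<close> including \<open>j = 0\<close>.\<close>

definition basis :: "nat \<Rightarrow> seq" where
  "basis j = (\<lambda>n. if n = j \<and> n \<noteq> 0 then 1 else 0)"

definition fin_supp :: "nat \<Rightarrow> seq \<Rightarrow> bool" where
  "fin_supp N f \<longleftrightarrow> f 0 = 0 \<and> (\<forall>n>N. f n = 0)"

lemma fin_supp_ell1: "fin_supp N f \<Longrightarrow> f \<in> ell1 w"
  unfolding fin_supp_def ell1_def
  by (auto intro!: summable_finite[of "{..N}"] simp: not_le[symmetric])

lemma fin_supp_wnorm: "fin_supp N f \<Longrightarrow> wnorm w f = (\<Sum>n\<le>N. w n * \<bar>f n\<bar>)"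
  unfolding fin_supp_def wnorm_def by (intro suminf_finite) auto

lemma fin_supp_basis: "j \<le> N \<Longrightarrow> fin_supp N (basis j)"
  by (auto simp: fin_supp_def basis_def)

lemma basis_ell1: "basis j \<in> ell1 w"
  by (rule fin_supp_ell1[OF fin_supp_basis[of j j]]) simp

lemma wnorm_basis: "1 \<le> j \<Longrightarrow> wnorm w (basis j) = w j"
  using fin_supp_wnorm[OF fin_supp_basis[of j j]] weight_pos[of j]
    sum.remove[of "{..j}" j "\<lambda>n. w n * \<bar>basis j n\<bar>"]
  by (simp add: basis_def)

lemma fin_supp_trunc: "f \<in> ell1 w \<Longrightarrow> fin_supp N (trunc N f)"
  by (auto simp: fin_supp_def trunc_def ell1_def)

lemma fin_supp_expand: "fin_supp N f \<Longrightarrow> (\<Sum>j\<le>N. f j * basis j n) = f n"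
  by (cases "n = 0 \<or> N < n")
    (auto simp: fin_supp_def basis_def if_distrib[of "(*) _"] sum.delta' cong: if_cong)

lemma trunc_tendsto:
  assumes "f \<in> ell1 w"
  shows "(\<lambda>N. wnorm w (\<lambda>n. trunc N f n - f n)) \<longlonglongrightarrow> 0"
proof -
  have "wnorm w (\<lambda>n. trunc N f n - f n) = (\<Sum>n. w (n + Suc N) * \<bar>f (n + Suc N)\<bar>)"
    for N
  proof -
    have ell: "(\<lambda>n. trunc N f n - f n) \<in> ell1 w"
      by (intro ell1_diff fin_supp_ell1[OF fin_supp_trunc] assms)
    have "wnorm w (\<lambda>n. trunc N f n - f n)
        = (\<Sum>n. w (n + Suc N) * \<bar>trunc N f (n + Suc N) - f (n + Suc N)\<bar>)
          + (\<Sum>n<Suc N. w n * \<bar>trunc N f n - f n\<bar>)"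
      unfolding wnorm_def by (rule suminf_split_initial_segment[OF ell1_summable[OF ell]])
    then show ?thesis by (simp add: trunc_def)
  qed
  moreover have "(\<lambda>N. \<Sum>n. w (n + Suc N) * \<bar>f (n + Suc N)\<bar>) \<longlonglongrightarrow> 0"
    by (rule LIMSEQ_Suc[OF suminf_exist_split2[OF ell1_summable[OF assms]]])
  ultimately show ?thesis by simp
qed

section \<open>Bounded operators on \<open>ell1 w\<close>\<close>

lemma bounded_op_ell1: "bounded_op w T \<Longrightarrow> f \<in> ell1 w \<Longrightarrow> T f \<in> ell1 w"
  by (simp add: bounded_op_def)

lemma bounded_op_add:
  "bounded_op w T \<Longrightarrow> f \<in> ell1 w \<Longrightarrow> g \<in> ell1 w \<Longrightarrow> T (\<lambda>n. f n + g n) = (\<lambda>n. T f n + T g n)"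
  by (simp add: bounded_op_def)

lemma bounded_op_scale:
  "bounded_op w T \<Longrightarrow> f \<in> ell1 w \<Longrightarrow> T (\<lambda>n. c * f n) = (\<lambda>n. c * T f n)"
  by (simp add: bounded_op_def)

lemma bounded_op_diff:
  assumes "bounded_op w T" "f \<in> ell1 w" "g \<in> ell1 w"
  shows "T (\<lambda>n. f n - g n) = (\<lambda>n. T f n - T g n)"
  using bounded_op_add[OF assms(1,2) ell1_scale[OF assms(3), of "-1"]]
    bounded_op_scale[OF assms(1,3), of "-1"] by simp

lemma bounded_op_bound:
  assumes "bounded_op w T"
  obtains C where "0 \<le> C" "\<And>f. f \<in> ell1 w \<Longrightarrow> wnorm w (T f) \<le> C * wnorm w f"
proof -
  obtain C where C: "\<And>f. f \<in> ell1 w \<Longrightarrow> wnorm w (T f) \<le> C * wnorm w f"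
    using assms unfolding bounded_op_def by blast
  show ?thesis
  proof (rule that[of "\<bar>C\<bar>"])
    fix f assume f: "f \<in> ell1 w"
    show "wnorm w (T f) \<le> \<bar>C\<bar> * wnorm w f"
      by (rule order_trans[OF C[OF f]]) (simp add: mult_right_mono wnorm_nonneg f)
  qed simp
qed

lemma bounded_op_sum:
  assumes "bounded_op w T" "finite J" "\<And>j. j \<in> J \<Longrightarrow> f j \<in> ell1 w"
  shows "T (\<lambda>n. \<Sum>j\<in>J. c j * f j n) = (\<lambda>n. \<Sum>j\<in>J. c j * T (f j) n)"
proof -
  have "(\<lambda>n. \<Sum>j\<in>J. c j * f j n) \<in> ell1 w
      \<and> T (\<lambda>n. \<Sum>j\<in>J. c j * f j n) = (\<lambda>n. \<Sum>j\<in>J. c j * T (f j) n)"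
    using assms(2,3)
  proof (induction J rule: finite_induct)
    case empty
    then show ?case using bounded_op_scale[OF assms(1) ell1_zero, of 0] by simp
  next
    case (insert k J)
    then show ?case
      using bounded_op_add[OF assms(1), of "\<lambda>n. c k * f k n" "\<lambda>n. \<Sum>j\<in>J. c j * f j n"]
        bounded_op_scale[OF assms(1), of "f k" "c k"]
      by (simp add: ell1_scale ell1_add)
  qed
  then show ?thesis ..
qed

text \<open>Linearity extends the agreement from unit vectors to finitely supported sequences; these
  are dense by \<open>trunc_tendsto\<close>, and both operators are continuous.\<close>

lemma bounded_op_eqI:
  assumes T: "bounded_op w T" and U: "bounded_op w U"
    and basis: "\<And>j. T (basis j) = U (basis j)" and f: "f \<in> ell1 w"
  shows "T f = U f"
proof -
  have fin: "T g = U g" if "fin_supp N g" for N g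
    using bounded_op_sum[OF T, of "{..N}" basis g] bounded_op_sum[OF U, of "{..N}" basis g]
    by (simp add: basis_ell1 basis fin_supp_expand[OF that])
  obtain C where C: "0 \<le> C" "\<And>f. f \<in> ell1 w \<Longrightarrow> wnorm w (T f) \<le> C * wnorm w f"
    using bounded_op_bound[OF T] by metis
  obtain D where D: "0 \<le> D" "\<And>f. f \<in> ell1 w \<Longrightarrow> wnorm w (U f) \<le> D * wnorm w f"
    using bounded_op_bound[OF U] by metis
  note ell = f fin_supp_ell1[OF fin_supp_trunc[OF f]] bounded_op_ell1[OF T] bounded_op_ell1[OF U]
  have "wnorm w (\<lambda>n. T f n - U f n) \<le> (C + D) * wnorm w (\<lambda>n. trunc N f n - f n)"
    for N
  proof -
    have "wnorm w (\<lambda>n. T f n - U f n)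
        \<le> wnorm w (\<lambda>n. T f n - T (trunc N f) n) + wnorm w (\<lambda>n. T (trunc N f) n - U f n)"
      by (intro wnorm_triangle ell)
    also have "\<dots> = wnorm w (T (\<lambda>n. trunc N f n - f n)) + wnorm w (U (\<lambda>n. trunc N f n - f n))"
      by (simp add: bounded_op_diff[OF T] bounded_op_diff[OF U] ell fin[OF fin_supp_trunc[OF f]]
          wnorm_minus_commute[of "T f"] wnorm_minus_commute[of "U f"])
    also have "\<dots> \<le> (C + D) * wnorm w (\<lambda>n. trunc N f n - f n)"
      unfolding distrib_right by (intro add_mono C D ell1_diff ell)
    finally show ?thesis .
  qed
  moreover have "(\<lambda>N. (C + D) * wnorm w (\<lambda>n. trunc N f n - f n)) \<longlonglongrightarrow> (C + D) * 0"
    by (intro tendsto_intros trunc_tendsto f)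
  ultimately have "wnorm w (\<lambda>n. T f n - U f n) \<le> 0"
    by (intro LIMSEQ_le_const) auto
  then show ?thesis by (intro ell1_eqI ell)
qed

lemma bounded_op_compose:
  assumes T: "bounded_op w T" and U: "bounded_op w U"
  shows "bounded_op w (\<lambda>f. T (U f))"
proof -
  obtain C where C: "0 \<le> C" "\<And>f. f \<in> ell1 w \<Longrightarrow> wnorm w (T f) \<le> C * wnorm w f"
    using bounded_op_bound[OF T] by metis
  obtain D where D: "0 \<le> D" "\<And>f. f \<in> ell1 w \<Longrightarrow> wnorm w (U f) \<le> D * wnorm w f"
    using bounded_op_bound[OF U] by metis
  have "wnorm w (T (U f)) \<le> (C * D) * wnorm w f" if "f \<in> ell1 w" for f
    using C(2)[OF bounded_op_ell1[OF U that]] mult_left_mono[OF D(2)[OF that] C(1)]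
    by (simp add: mult.assoc)
  then show ?thesis
    unfolding bounded_op_def
    by (auto simp: bounded_op_ell1[OF T] bounded_op_ell1[OF U] bounded_op_add[OF T]
        bounded_op_add[OF U] bounded_op_scale[OF T] bounded_op_scale[OF U])
qed

end

section \<open>Semigroups on weighted sequence spaces\<close>

context ell1_weight
begin

text \<open>\<open>K\<close> is the operator norm, taken as a supremum over the unit ball. The
  vector \<open>g\<close> forces it to be at least \<open>c\<close>, hence positive, so that some
  unit ball vector attains the fraction 3/4 of it.\<close>

lemma bounded_op_norming_vector:
  assumes T: "bounded_op w T" and g: "g \<in> ell1 w" "c * wnorm w g < wnorm w (T g)" and "0 < c"
  obtains K f where "c \<le> K" "\<And>h. h \<in> ell1 w \<Longrightarrow> wnorm w (T h) \<le> K * wnorm w h"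
    "f \<in> ell1 w" "wnorm w f \<le> 1" "3/4 * K \<le> wnorm w (T f)"
proof -
  obtain C where C: "0 \<le> C" "\<And>f. f \<in> ell1 w \<Longrightarrow> wnorm w (T f) \<le> C * wnorm w f"
    using bounded_op_bound[OF T] by metis
  define A where "A = {wnorm w (T f) | f. f \<in> ell1 w \<and> wnorm w f \<le> 1}"
  have bdd: "bdd_above A"
  proof (rule bdd_aboveI[of _ C])
    fix y assume "y \<in> A"
    then obtain f where f: "f \<in> ell1 w" "wnorm w f \<le> 1" "y = wnorm w (T f)"
      by (auto simp: A_def)
    then show "y \<le> C" using C(2)[OF f(1)] mult_left_mono[OF f(2) C(1)] by simp
  qed
  have bound: "wnorm w (T h) \<le> Sup A * wnorm w h" if h: "h \<in> ell1 w" for h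
  proof (cases "wnorm w h = 0")
    case True
    then show ?thesis using C(2)[OF h] by simp
  next
    case False
    then have pos: "0 < wnorm w h" using wnorm_nonneg[OF h] by simp
    have "wnorm w (T (\<lambda>n. (1 / wnorm w h) * h n)) \<in> A"
      unfolding A_def using ell1_scale[OF h, of "1 / wnorm w h"] wnorm_scale[OF h, of "1 / wnorm w h"] pos
      by (intro CollectI exI[of _ "\<lambda>n. (1 / wnorm w h) * h n"]) simp
    then have "wnorm w (T (\<lambda>n. (1 / wnorm w h) * h n)) \<le> Sup A"
      by (rule cSup_upper[OF _ bdd])
    then show ?thesis
      unfolding bounded_op_scale[OF T h] wnorm_scale[OF bounded_op_ell1[OF T h]]
      using pos by (simp add: field_simps)
  qed
  have gpos: "0 < wnorm w g"
    using g C(2)[OF g(1)] wnorm_nonneg[OF g(1)] by (cases "wnorm w g = 0") auto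
  have "c * wnorm w g < Sup A * wnorm w g" using g(2) bound[OF g(1)] by simp
  then have cK: "c \<le> Sup A" using gpos by simp
  have "wnorm w (T (\<lambda>n. 0)) \<in> A"
    unfolding A_def by (intro CollectI exI[of _ "\<lambda>n. 0"]) simp
  then have "A \<noteq> {}" by blast
  then obtain y where "y \<in> A" "3/4 * Sup A < y"
    using less_cSupD[of A "3/4 * Sup A"] cK \<open>0 < c\<close> by auto
  then show ?thesis using that[OF cK bound] by (auto simp: A_def)
qed

text \<open>
  Banach--Steinhaus by a gliding hump: adding \<open>\<plusminus> 3\<^sup>-\<^sup>k f k\<close>, where \<open>f k\<close> almost norms \<open>U k\<close>, makes
  \<open>U k x\<close> large
    for one choice of the sign, and the later summands are too small to undo this.
\<close>

lemma gliding_hump: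
  assumes U: "\<And>k. bounded_op w (U k)"
    and K: "\<And>k h. h \<in> ell1 w \<Longrightarrow> wnorm w (U k h) \<le> K k * wnorm w h"
    and f: "\<And>k. f k \<in> ell1 w" "\<And>k. wnorm w (f k) \<le> 1" "\<And>k. 3/4 * K k \<le> wnorm w (U k (f k))"
    and K0: "\<And>k. 0 \<le> K k"
  shows "\<exists>x\<in>ell1 w. \<forall>k. K k / (4 * 3 ^ k) \<le> wnorm w (U k x)"
proof -
  define plus where "plus k y = (\<lambda>n. y n + (1/3)^k * f k n)" for k and y :: seq
  define minus where "minus k y = (\<lambda>n. y n - (1/3)^k * f k n)" for k and y :: seq
  define good where "good k y \<longleftrightarrow> 3/4 * K k / 3^k \<le> wnorm w (U k y)" for k y
  define x where "x = rec_nat (\<lambda>n. 0) (\<lambda>k y. if good k (plus k y) then plus k y else minus k y)"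
  have x_Suc: "x (Suc k) = (if good k (plus k (x k)) then plus k (x k) else minus k (x k))" for k
    by (simp add: x_def)
  have sf: "(\<lambda>n. (1/3)^k * f k n) \<in> ell1 w" for k by (intro ell1_scale f)
  have x_ell: "x k \<in> ell1 w" for k
  proof (induction k)
    case 0
    then show ?case by (simp add: x_def)
  next
    case (Suc k)
    then show ?case using sf[of k] by (simp add: x_Suc plus_def minus_def ell1_add ell1_diff)
  qed
  \<comment> \<open>The two candidates differ by twice the added hump, so by the triangle inequality
    \<open>U k\<close> cannot make both of them small.\<close>
  have x_good: "good k (x (Suc k))" for k
  proof (rule ccontr)
    assume "\<not> good k (x (Suc k))"
    then have *: "wnorm w (U k (plus k (x k))) < 3/4 * K k / 3^k"
        "wnorm w (U k (minus k (x k))) < 3/4 * K k / 3^k"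
      by (auto simp: x_Suc good_def split: if_splits)
    have "2 * ((1/3)^k * (3/4 * K k)) \<le> 2 * ((1/3)^k * wnorm w (U k (f k)))"
      using f(3)[of k] by simp
    also have "\<dots> = wnorm w (\<lambda>n. 2 * ((1/3)^k * U k (f k) n))"
      by (simp add: wnorm_scale ell1_scale bounded_op_ell1[OF U] f)
    also have "(\<lambda>n. 2 * ((1/3)^k * U k (f k) n)) = (\<lambda>n. U k (plus k (x k)) n - U k (minus k (x k)) n)"
      unfolding plus_def minus_def
      by (simp add: bounded_op_add[OF U x_ell sf] bounded_op_diff[OF U x_ell sf] bounded_op_scale[OF U f(1)]) (simp add: mult.commute)
    also have "wnorm w \<dots> \<le> wnorm w (U k (plus k (x k))) + wnorm w (U k (minus k (x k)))"
      unfolding plus_def minus_def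
        by (intro wnorm_diff bounded_op_ell1[OF U] ell1_add ell1_diff x_ell sf)
    finally show False using * by (simp add: power_one_over field_simps)
  qed
  define d where "d k = (\<lambda>n. x (Suc k) n - x k n)" for k
  have d_ell: "d k \<in> ell1 w" for k unfolding d_def by (intro ell1_diff x_ell)
  have d_norm: "wnorm w (d k) \<le> (1/3)^k" for k
  proof -
    have "d k = (\<lambda>n. (1/3)^k * f k n) \<or> d k = (\<lambda>n. (-((1/3)^k)) * f k n)"
      by (auto simp: d_def x_Suc plus_def minus_def)
    then have "wnorm w (d k) = (1/3)^k * wnorm w (f k)"
      using wnorm_scale[OF f(1), of "(1/3)^k" k] wnorm_scale[OF f(1), of "-((1/3)^k)" k] by auto
    then show ?thesis using f(2)[of k] mult_left_mono[of "wnorm w (f k)" 1 "(1/3)^k"] by simp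
  qed
  have x_sum: "x k n = (\<Sum>j<k. d j n)" for k n
    by (induction k) (simp_all add: d_def x_def[THEN fun_cong, of 0])
  define y where "y = (\<lambda>n. \<Sum>j. d j n)"
  have geom: "summable (\<lambda>j. (1/3::real)^j)" by (rule summable_geometric) simp
  note ser = ell1_series[of d, OF d_ell d_norm geom]
  have y_ell: "y \<in> ell1 w" unfolding y_def by (rule ser)
  have tail: "wnorm w (\<lambda>n. x k n - y n) \<le> 3/2 * (1/3)^k" for k
  proof -
    have "y n - x k n = (\<Sum>j. d (j + k) n)" for n
      using suminf_split_initial_segment[OF ser(1), of n k] by (simp add: y_def x_sum)
    moreover have "wnorm w (\<lambda>n. \<Sum>j. d (j + k) n) \<le> (\<Sum>j. (1/3::real)^(j + k))"
      using d_ell d_norm summable_ignore_initial_segment[OF geom, of k]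
      by (intro ell1_series(3)) auto
    moreover have "(\<Sum>j. (1/3::real)^(j + k)) = 3/2 * (1/3)^k"
      using suminf_mult2[OF geom, of "(1/3)^k"] suminf_geometric[of "1/3::real"]
      by (simp add: power_add)
    ultimately show ?thesis by (simp add: wnorm_minus_commute[of "x k"])
  qed
  show ?thesis
  proof (intro bexI[OF _ y_ell] allI)
    fix k
    \<comment> \<open>The constants meet here: the summands after stage \<open>k\<close> have total
      norm at most 1/2 of \<open>(1/3)^k\<close>, and 3/4 - 1/2 = 1/4 is the fraction that
      survives.\<close>
    have "3/4 * K k / 3^k - wnorm w (U k y) \<le> wnorm w (U k (x (Suc k))) - wnorm w (U k y)"
      using x_good[of k] by (simp add: good_def)
    also have "\<dots> \<le> wnorm w (U k (\<lambda>n. x (Suc k) n - y n))"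
      unfolding bounded_op_diff[OF U x_ell y_ell]
      by (intro wnorm_reverse_triangle bounded_op_ell1[OF U] x_ell y_ell)
    also have "\<dots> \<le> K k * (3/2 * (1/3)^Suc k)"
      by (intro order_trans[OF K] mult_left_mono tail K0 ell1_diff x_ell y_ell)
    finally show "K k / (4 * 3 ^ k) \<le> wnorm w (U k y)"
      by (simp add: power_one_over field_simps)
  qed
qed

text \<open>Without a uniform bound there are operators of norm at least \<open>4^k\<close>. The
  hump vector loses only a factor \<open>4 * 3^k\<close>, so its images grow at least like
  \<open>(4/3)^k\<close>, against the pointwise bound.\<close>

lemma uniform_boundedness:
  assumes T: "\<And>n::nat. bounded_op w (T n)"
    and ptw: "\<And>f. f \<in> ell1 w \<Longrightarrow> \<exists>B. \<forall>n. wnorm w (T n f) \<le> B"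
  shows "\<exists>C. \<forall>n. \<forall>f\<in>ell1 w. wnorm w (T n f) \<le> C * wnorm w f"
proof (rule ccontr)
  assume *: "\<not> ?thesis"
  have "\<exists>n K f. 4^k \<le> K \<and> (\<forall>h\<in>ell1 w. wnorm w (T n h) \<le> K * wnorm w h)
      \<and> f \<in> ell1 w \<and> wnorm w f \<le> 1 \<and> 3/4 * K \<le> wnorm w (T n f)" for k :: nat
  proof -
    have "\<exists>n. \<exists>g\<in>ell1 w. 4^k * wnorm w g < wnorm w (T n g)"
      using * by (force simp: not_le)
    then obtain n g where g: "g \<in> ell1 w" "4^k * wnorm w g < wnorm w (T n g)"
      by blast
    show ?thesis
      by (rule bounded_op_norming_vector[OF T g]) (simp, intro exI conjI ballI)
  qed
  then have "\<forall>k::nat. \<exists>n K f. 4^k \<le> K \<and> (\<forall>h\<in>ell1 w. wnorm w (T n h) \<le> K * wnorm w h)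
      \<and> f \<in> ell1 w \<and> wnorm w f \<le> 1 \<and> 3/4 * K \<le> wnorm w (T n f)"
    by (rule allI)
  then have "\<exists>N K f. \<forall>k::nat. 4^k \<le> K k \<and> (\<forall>h\<in>ell1 w. wnorm w (T (N k) h) \<le> K k * wnorm w h)
      \<and> f k \<in> ell1 w \<and> wnorm w (f k) \<le> 1 \<and> 3/4 * K k \<le> wnorm w (T (N k) (f k))"
    unfolding choice_iff .
  then obtain N K f where *: "\<forall>k::nat. 4^k \<le> K k
      \<and> (\<forall>h\<in>ell1 w. wnorm w (T (N k) h) \<le> K k * wnorm w h)
      \<and> f k \<in> ell1 w \<and> wnorm w (f k) \<le> 1 \<and> 3/4 * K k \<le> wnorm w (T (N k) (f k))"
    by (elim exE)
  then have sel: "\<And>k. 4^k \<le> K k"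
      "\<And>k h. h \<in> ell1 w \<Longrightarrow> wnorm w (T (N k) h) \<le> K k * wnorm w h"
      "\<And>k. f k \<in> ell1 w" "\<And>k. wnorm w (f k) \<le> 1" "\<And>k. 3/4 * K k \<le> wnorm w (T (N k) (f k))"
    by simp_all
  have K0: "0 \<le> K k" for k using sel(1)[of k] order_trans[of 0 "4^k" "K k"] by simp
  have "\<exists>x\<in>ell1 w. \<forall>k. K k / (4 * 3 ^ k) \<le> wnorm w (T (N k) x)"
    by (rule gliding_hump[of "\<lambda>k. T (N k)", OF T sel(2-5) K0])
  then obtain x where x: "x \<in> ell1 w" "\<And>k. K k / (4 * 3 ^ k) \<le> wnorm w (T (N k) x)"
    by blast
  obtain B where B: "\<And>n. wnorm w (T n x) \<le> B" using ptw[OF x(1)] by metis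
  have "(4/3)^k / 4 \<le> B" for k :: nat
  proof -
    have "(4/3)^k / 4 = 4^k / (4 * 3^k :: real)" by (simp add: power_divide)
    also have "\<dots> \<le> K k / (4 * 3^k)" by (intro divide_right_mono sel) simp
    also have "\<dots> \<le> B" by (rule order_trans[OF x(2) B])
    finally show ?thesis .
  qed
  then have "(4/3)^k \<le> 4 * B" for k :: nat by (simp add: field_simps)
  moreover obtain k where "4 * B < (4/3)^k" using real_arch_pow[of "4/3" "4*B"] by auto
  ultimately show False by (simp add: leD)
qed

section \<open>Local bounds and coordinate derivatives for arbitrary C0-semigroups\<close>

lemma C0_bounded_op: "C0_semigroup w S \<Longrightarrow> 0 \<le> t \<Longrightarrow> bounded_op w (S t)"
  by (simp add: C0_semigroup_def)

lemma C0_zero: "C0_semigroup w S \<Longrightarrow> f \<in> ell1 w \<Longrightarrow> S 0 f = f"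
  by (simp add: C0_semigroup_def)

lemma C0_add: "C0_semigroup w S \<Longrightarrow> 0 \<le> s \<Longrightarrow> 0 \<le> t \<Longrightarrow> f \<in> ell1 w \<Longrightarrow> S (s + t) f = S s (S t f)"
  by (simp add: C0_semigroup_def)

lemma C0_strong:
  "C0_semigroup w S \<Longrightarrow> f \<in> ell1 w \<Longrightarrow> ((\<lambda>t. wnorm w (\<lambda>n. S t f n - f n)) \<longlongrightarrow> 0) (at_right 0)"
  by (simp add: C0_semigroup_def)

text \<open>If no bound held near 0, some times tending to 0 would carry operators of unbounded
  norm. Strong continuity at 0 bounds each orbit along these times, which contradicts
  \<open>uniform_boundedness\<close>.\<close>

lemma C0_bounded_near_zero:
  assumes S: "C0_semigroup w S"
  shows "\<exists>\<delta>>0. \<exists>M. \<forall>t. 0 \<le> t \<and> t \<le> \<delta> \<longrightarrow> (\<forall>f\<in>ell1 w. wnorm w (S t f) \<le> M * wnorm w f)"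
proof (rule ccontr)
  assume *: "\<not> ?thesis"
  have "\<exists>t. 0 \<le> t \<and> t \<le> 1 / real (Suc k) \<and> (\<exists>f\<in>ell1 w. real (Suc k) * wnorm w f < wnorm w (S t f))" for k
    using * by (metis not_le of_nat_0_less_iff zero_less_Suc zero_less_divide_1_iff)
  then obtain t where t: "\<And>k. 0 \<le> t k" "\<And>k. t k \<le> 1 / real (Suc k)"
      "\<And>k. \<exists>f\<in>ell1 w. real (Suc k) * wnorm w f < wnorm w (S (t k) f)"
    by metis
  \<comment> \<open>\<open>S 0\<close> is the identity, so the growth inequality excludes
    \<open>t k = 0\<close>; strictly positive times are required for the limit from the
    right.\<close>
  have pos: "0 < t k" if "1 \<le> k" for k
  proof (rule ccontr)
    assume "\<not> 0 < t k"
    then have "t k = 0" using t(1)[of k] by simp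
    with t(3)[of k] obtain f where "f \<in> ell1 w" "real (Suc k) * wnorm w f < wnorm w f"
      using C0_zero[OF S] by metis
    then show False using wnorm_nonneg[of f] by (simp add: distrib_right mult_less_0_iff)
  qed
  have lim: "(\<lambda>k. t (Suc k)) \<longlonglongrightarrow> 0"
    by (rule tendsto_sandwich[OF _ _ tendsto_const LIMSEQ_Suc[OF LIMSEQ_Suc[OF lim_1_over_n]]])
      (use t(1) t(2)[of "Suc _", simplified] in \<open>auto intro!: always_eventually simp: add.commute\<close>)
  have at_right: "filterlim (\<lambda>k. t (Suc k)) (at_right 0) sequentially"
    unfolding filterlim_at using lim pos[THEN less_imp_neq] pos by (auto intro!: always_eventually)
  have "\<exists>C. \<forall>n. \<forall>f\<in>ell1 w. wnorm w (S (t (Suc n)) f) \<le> C * wnorm w f"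
  proof (rule uniform_boundedness)
    show "bounded_op w (S (t (Suc n)))" for n by (rule C0_bounded_op[OF S t(1)])
    fix f assume f: "f \<in> ell1 w"
    have "(\<lambda>k. wnorm w (\<lambda>n. S (t (Suc k)) f n - f n)) \<longlonglongrightarrow> 0"
      by (rule filterlim_compose[OF C0_strong[OF S f] at_right])
    then have "Bseq (\<lambda>k. wnorm w (\<lambda>n. S (t (Suc k)) f n - f n))"
      by (rule convergent_imp_Bseq[OF convergentI])
    then obtain B where B: "\<And>k. \<bar>wnorm w (\<lambda>n. S (t (Suc k)) f n - f n)\<bar> \<le> B"
      by (auto simp: Bseq_def)
    have "wnorm w (S (t (Suc k)) f) \<le> B + wnorm w f" for k
      using B[of k] wnorm_reverse_triangle[OF bounded_op_ell1[OF C0_bounded_op[OF S t(1)] f] f, of "Suc k"]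
      by linarith
    then show "\<exists>B. \<forall>n. wnorm w (S (t (Suc n)) f) \<le> B" by blast
  qed
  then obtain C where C: "\<And>n f. f \<in> ell1 w \<Longrightarrow> wnorm w (S (t (Suc n)) f) \<le> C * wnorm w f" by metis
  obtain n :: nat where n: "C < real n" using reals_Archimedean2 by blast
  obtain f where f: "f \<in> ell1 w" "real (Suc (Suc n)) * wnorm w f < wnorm w (S (t (Suc n)) f)"
    using t(3) by blast
  have "C * wnorm w f \<le> real (Suc (Suc n)) * wnorm w f"
    using n by (intro mult_right_mono wnorm_nonneg f) simp
  then show False using f C[OF f(1), of n] by linarith
qed

text \<open>The semigroup law splits \<open>[0, \<tau>]\<close> into steps of length at most
  \<open>\<delta>\<close>, each costing one factor of the bound near zero.\<close>

lemma C0_bounded_on: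
  assumes S: "C0_semigroup w S"
  obtains M where "0 \<le> M" "\<And>t f. 0 \<le> t \<Longrightarrow> t \<le> \<tau> \<Longrightarrow> f \<in> ell1 w \<Longrightarrow> wnorm w (S t f) \<le> M * wnorm w f"
proof -
  obtain \<delta> M0 where d: "\<delta> > 0"
    and M0: "\<And>t f. 0 \<le> t \<Longrightarrow> t \<le> \<delta> \<Longrightarrow> f \<in> ell1 w \<Longrightarrow> wnorm w (S t f) \<le> M0 * wnorm w f"
    using C0_bounded_near_zero[OF S] by metis
  \<comment> \<open>With \<open>M\<close> at least 1, a bound for fewer steps is also a bound for
    more steps.\<close>
  define M where "M = max 1 M0"
  have M: "wnorm w (S t f) \<le> M * wnorm w f" if "0 \<le> t" "t \<le> \<delta>" "f \<in> ell1 w"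
    for t f
    by (rule order_trans[OF M0[OF that]]) (simp add: M_def mult_right_mono wnorm_nonneg that)
  have M1: "1 \<le> M" by (simp add: M_def)
  have pow: "wnorm w (S t f) \<le> M ^ Suc k * wnorm w f"
    if "0 \<le> t" "t \<le> real (Suc k) * \<delta>" "f \<in> ell1 w" for k t f
    using that
  proof (induction k arbitrary: t f)
    case 0
    then show ?case using M by simp
  next
    case (Suc k)
    show ?case
    proof (cases "t \<le> \<delta>")
      case True
      have "wnorm w (S t f) \<le> M * wnorm w f" using M True Suc.prems by simp
      also have "\<dots> \<le> M ^ Suc (Suc k) * wnorm w f"
        using M1 power_increasing[of 1 "Suc (Suc k)" M]
          by (intro mult_right_mono wnorm_nonneg Suc.prems) auto
      finally show ?thesis .
    next
      case False
      have le: "t - \<delta> \<le> real (Suc k) * \<delta>" using Suc.prems by (simp add: algebra_simps)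
      have "S t f = S \<delta> (S (t - \<delta>) f)"
        using C0_add[OF S, of \<delta> "t - \<delta>" f] d False Suc.prems by simp
      then have "wnorm w (S t f) \<le> M * wnorm w (S (t - \<delta>) f)"
        using M[of \<delta> "S (t - \<delta>) f"] d False bounded_op_ell1[OF C0_bounded_op[OF S, of "t - \<delta>"]] Suc.prems
        by simp
      also have "\<dots> \<le> M * (M ^ Suc k * wnorm w f)"
        using M1 False le Suc.prems by (intro mult_left_mono Suc.IH) auto
      finally show ?thesis by (simp add: mult.assoc)
    qed
  qed
  obtain k :: nat where "\<tau> / \<delta> < real k" using reals_Archimedean2 by blast
  then have k: "\<tau> \<le> real (Suc k) * \<delta>"
    using d by (simp add: pos_divide_less_eq distrib_right)
  show ?thesis
  proof (rule that[of "M ^ Suc k"])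
    show "0 \<le> M ^ Suc k" using M1 by simp
    show "wnorm w (S t f) \<le> M ^ Suc k * wnorm w f" if "0 \<le> t" "t \<le> \<tau>" "f \<in> ell1 w"
      for t f
      by (rule pow) (use that k in auto)
  qed
qed

text \<open>The generator only provides the right derivative at time 0. The semigroup law transports
  it to any time; on the left this uses that the operators \<open>S y\<close> are uniformly bounded
  for \<open>y\<close> up to \<open>t\<close>. Coordinatewise derivatives suffice for
  \<open>semi_unique\<close>.\<close>

lemma C0_orbit_derivative:
  assumes S: "C0_semigroup w S" and fg: "(f, g) \<in> generator w S" and t: "0 \<le> t"
  shows "((\<lambda>s. S s f n) has_real_derivative S t g n) (at t within {0..})"
proof (cases "n = 0")
  case True
  have f: "f \<in> ell1 w" and g: "g \<in> ell1 w" using fg by (auto simp: generator_def)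
  have "S t g 0 = 0" by (rule ell1_zero_index[OF bounded_op_ell1[OF C0_bounded_op[OF S t] g]])
  moreover have "((\<lambda>s. S s f 0) has_real_derivative 0) (at t within {0..})"
    by (rule has_field_derivative_transform_within[OF DERIV_const[of 0] zero_less_one])
      (use t ell1_zero_index[OF bounded_op_ell1[OF C0_bounded_op[OF S] f]] in auto)
  ultimately show ?thesis using True by simp
next
  case False
  have f: "f \<in> ell1 w" and g: "g \<in> ell1 w"
    and lim: "((\<lambda>t. wnorm w (\<lambda>n. (S t f n - f n) / t - g n)) \<longlongrightarrow> 0) (at_right 0)"
    using fg by (auto simp: generator_def)
  obtain M where M: "0 \<le> M"
      "\<And>s f. 0 \<le> s \<Longrightarrow> s \<le> t \<Longrightarrow> f \<in> ell1 w \<Longrightarrow> wnorm w (S s f) \<le> M * wnorm w f"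
    using C0_bounded_on[OF S, of t] by metis
  define q where "q h = (\<lambda>n. (S h f n - f n) / h - g n)" for h
  \<comment> \<open>One error bound for both sides; the second summand is needed only for quotients
    from the left.\<close>
  define r where "r h = M / w n * (wnorm w (q h) + wnorm w (\<lambda>n. S h g n - g n))" for h
  have w: "0 < w n" using False weight_pos by simp
  have ell: "S s h \<in> ell1 w" if "0 \<le> s" "h \<in> ell1 w" for s h
    by (rule bounded_op_ell1[OF C0_bounded_op[OF S that(1)] that(2)])
  have Shg: "(\<lambda>n. S h g n - g n) \<in> ell1 w" if "0 \<le> h" for h
    by (intro ell1_diff ell g that)
  have q0: "(\<lambda>n. (S h f n - f n) / h) \<in> ell1 w" if "0 \<le> h" for h
    using ell1_scale[OF ell1_diff[OF ell[OF that f] f], of "1 / h"] by simp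
  have q: "q h \<in> ell1 w" if "0 \<le> h" for h
    unfolding q_def by (intro ell1_diff q0 g that)
  have r: "(r \<longlongrightarrow> 0) (at_right 0)"
    unfolding r_def q_def
      using tendsto_mult[OF tendsto_const[of "M / w n"] tendsto_add[OF lim C0_strong[OF S g]]]
    by simp
  have bound: "\<bar>(S y f n - S t f n) / (y - t) - S t g n\<bar> \<le> r \<bar>y - t\<bar>"
    if y: "0 \<le> y" "y \<noteq> t" for y
  proof (cases "t < y")
    case True
    define h where "h = y - t"
    have h: "0 < h" "y = t + h" using True by (auto simp: h_def)
    have "S t (q h) n = (S y f n - S t f n) / (y - t) - S t g n"
    proof -
      have "S t (q h) n = S t (\<lambda>n. (1/h) * (S h f n - f n)) n - S t g n"
        unfolding q_def using bounded_op_diff[OF C0_bounded_op[OF S t] q0[of h] g] h by simp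
      also have "\<dots> = (1/h) * (S t (S h f) n - S t f n) - S t g n"
        using h by (simp add: bounded_op_scale[OF C0_bounded_op[OF S t]] bounded_op_diff[OF C0_bounded_op[OF S t]] ell1_diff ell f
            del: times_divide_eq_left times_divide_eq_right)
      also have "S t (S h f) = S y f" using C0_add[OF S t, of h f] h f by simp
      finally show ?thesis using h by simp
    qed
    moreover have "\<bar>S t (q h) n\<bar> \<le> M * wnorm w (q h) / w n"
      using h \<open>n \<noteq> 0\<close> by (intro coord_le ell M q t) auto
    moreover have "\<dots> \<le> r h"
      using M(1) w wnorm_nonneg[OF Shg[of h]] h
      by (simp add: r_def divide_right_mono mult_left_mono)
    ultimately show ?thesis using h by simp
  next
    case False
    \<comment> \<open>From the left the quotient is \<open>S y\<close> applied to the quotient at 0,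
      while the target is \<open>S t g = S y (S h g)\<close>. Replacing \<open>g\<close> by
      \<open>S h g\<close> accounts for the correction in \<open>?d\<close>.\<close>
    define h where "h = t - y"
    have h: "0 < h" "t = y + h" using False y by (auto simp: h_def)
    let ?d = "\<lambda>n. q h n - (S h g n - g n)"
    have "S y ?d n = (S y f n - S t f n) / (y - t) - S t g n"
    proof -
      have "S y ?d n = S y (q h) n - S y (\<lambda>n. S h g n - g n) n"
        using bounded_op_diff[OF C0_bounded_op[OF S y(1)] q[of h] Shg[of h]] h by simp
      also have "S y (q h) n = S y (\<lambda>n. (1/h) * (S h f n - f n)) n - S y g n"
        unfolding q_def using bounded_op_diff[OF C0_bounded_op[OF S y(1)] q0[of h] g] h by simp
      also have "S y (\<lambda>n. (1/h) * (S h f n - f n)) n = (1/h) * (S y (S h f) n - S y f n)"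
        using h by (simp add: bounded_op_scale[OF C0_bounded_op[OF S y(1)]] bounded_op_diff[OF C0_bounded_op[OF S y(1)]] ell1_diff ell f
            del: times_divide_eq_left times_divide_eq_right)
      also have "S y (\<lambda>n. S h g n - g n) n = S y (S h g) n - S y g n"
        using h by (simp add: bounded_op_diff[OF C0_bounded_op[OF S y(1)]] ell g)
      also have "S y (S h f) = S t f" using C0_add[OF S y(1), of h f] h f by simp
      also have "S y (S h g) = S t g" using C0_add[OF S y(1), of h g] h g by simp
      finally show ?thesis using h by (simp add: field_simps)
    qed
    moreover have "\<bar>S y ?d n\<bar> \<le> M * wnorm w ?d / w n"
      using h \<open>n \<noteq> 0\<close> by (intro coord_le ell M ell1_diff[of "q h"] q Shg y) auto
    moreover have "\<dots> \<le> r h"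
      using M(1) w wnorm_diff[OF q[of h] Shg[of h]] h
      by (simp add: r_def divide_right_mono mult_left_mono)
    ultimately show ?thesis using h by simp
  qed
  have "((\<lambda>y. \<bar>y - t\<bar>) \<longlongrightarrow> \<bar>t - t\<bar>) (at t within {0..})"
    by (intro tendsto_intros)
  then have "filterlim (\<lambda>y. \<bar>y - t\<bar>) (at_right 0) (at t within {0..})"
    unfolding filterlim_at by (simp add: eventually_at_filter)
  from filterlim_compose[OF r this]
  have "((\<lambda>y. r \<bar>y - t\<bar>) \<longlongrightarrow> 0) (at t within {0..})" .
  then have "((\<lambda>y. (S y f n - S t f n) / (y - t) - S t g n) \<longlongrightarrow> 0) (at t within {0..})"
    by (rule Lim_null_comparison[rotated]) (simp add: eventually_at_filter bound)
  then show ?thesis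
    unfolding has_field_derivative_iff by (rule LIM_zero_cancel)
qed

end

section \<open>Finite triangular systems and the kernel semigroup\<close>

text \<open>The order of induction suited to an upper triangular matrix: coordinate \<open>n\<close>
  is influenced only by coordinates with larger index, and those above \<open>N\<close> are
  trivial.\<close>

lemma downward_induct [consumes 0, case_names above step]:
  fixes n N :: nat
  assumes "\<And>n. N < n \<Longrightarrow> P n" and "\<And>n. n \<le> N \<Longrightarrow> (\<And>i. n < i \<Longrightarrow> P i) \<Longrightarrow> P n"
  shows "P n"
proof (induction "Suc N - n" arbitrary: n rule: less_induct)
  case less
  show ?case
  proof (cases "N < n")
    case False
    show ?thesis
    proof (rule assms(2))
      show "P i" if "n < i" for i using less False that by simp
    qed (use False in simp)
  qed (rule assms(1))
qed

text \<open>By \<open>loc\<close> the condition at \<open>n\<close> sees only indices from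
  \<open>n\<close> on, so values chosen later at smaller indices cannot spoil it. It serves both the
  differential system and the resolvent equation.\<close>

lemma downward_recursion:
  fixes Q :: "nat \<Rightarrow> (nat \<Rightarrow> 'b) \<Rightarrow> bool"
  assumes ex: "\<And>n x. n \<le> N \<Longrightarrow> \<exists>z. Q n (x(n := z))"
    and loc: "\<And>n x y. (\<And>i. n \<le> i \<Longrightarrow> x i = y i) \<Longrightarrow> Q n x \<Longrightarrow> Q n y"
  shows "\<exists>x. (\<forall>n\<le>N. Q n x) \<and> (\<forall>n>N. x n = c)"
proof -
  have "\<exists>x. (\<forall>n\<le>N. m \<le> n \<longrightarrow> Q n x) \<and> (\<forall>n>N. x n = c)"
    if "m \<le> Suc N" for m
    using that
  proof (induction m rule: inc_induct)
    case base
    then show ?case by (intro exI[of _ "\<lambda>n. c"]) auto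
  next
    case (step m)
    then obtain x where x: "\<And>n. n \<le> N \<Longrightarrow> Suc m \<le> n \<Longrightarrow> Q n x" "\<And>n. N < n \<Longrightarrow> x n = c" by blast
    obtain z where z: "Q m (x(m := z))" using ex[of m x] step by auto
    have "Q n (x(m := z))" if "n \<le> N" "m \<le> n" for n
    proof (cases "n = m")
      case False
      then have "Q n x" using x(1)[of n] that by simp
      then show ?thesis by (rule loc[rotated]) (use False that in auto)
    qed (use z in simp)
    moreover have "(x(m := z)) n = c" if "N < n" for n using x(2) that step by auto
    ultimately show ?case by blast
  qed
  from this[of 0] show ?thesis by simp
qed

text \<open>Variation of constants; infinite interval endpoints yield an antiderivative on the whole
  line.\<close>

lemma scalar_linear_ode:
  fixes g :: "real \<Rightarrow> real"
  assumes "\<And>t. isCont g t"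
  shows "\<exists>y. y 0 = c \<and> (\<forall>t. (y has_real_derivative r * y t + g t) (at t))"
proof -
  have "\<exists>F. \<forall>t. -\<infinity> < ereal t \<longrightarrow> ereal t < \<infinity> \<longrightarrow> (F has_vector_derivative exp (- (r * t)) * g t) (at t)"
    by (rule einterval_antiderivative) (auto intro!: continuous_intros assms)
  then obtain F where F: "(F has_real_derivative exp (- (r * t)) * g t) (at t)" for t
    by (auto simp: has_real_derivative_iff_has_vector_derivative)
  define y where "y t = exp (r * t) * (c + F t - F 0)" for t
  have "(y has_real_derivative r * y t + g t) (at t)" for t
    unfolding y_def
    by (rule derivative_eq_intros F refl)+ (simp add: algebra_simps flip: exp_add)
  then show ?thesis by (intro exI[of _ y]) (simp add: y_def)
qed

section \<open>The triangular matrix and its weighted column sums\<close>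

locale frag_system = ell1_weight +
  fixes a :: seq and b :: "nat \<Rightarrow> nat \<Rightarrow> real"
  assumes a_nonneg: "1 \<le> n \<Longrightarrow> 0 \<le> a n"
    and b_nonneg: "1 \<le> n \<Longrightarrow> 1 \<le> j \<Longrightarrow> 0 \<le> b n j"
    and mass_le: "2 \<le> j \<Longrightarrow> (\<Sum>n\<in>{1..<j}. w n * b n j) \<le> w j"
begin

text \<open>The matrix of \<open>A + B\<close>; row \<open>0\<close> is made to vanish to match the dummy index of sequences.\<close>

definition rate :: "nat \<Rightarrow> nat \<Rightarrow> real" where
  "rate n i = (if n = 0 \<or> i < n then 0 else if n = i then - a n else a i * b n i)"

definition frag :: "seq \<Rightarrow> seq" where
  "frag f = (\<lambda>n. \<Sum>i. rate n i * f i)"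

lemma rate_off_diagonal_nonneg: "n \<noteq> i \<Longrightarrow> 0 \<le> rate n i"
  unfolding rate_def using a_nonneg b_nonneg by auto

lemma rate_gain_le:
  assumes "1 \<le> i"
  shows "(\<Sum>n\<in>{1..<i}. w n * rate n i) \<le> a i * w i"
proof -
  have "(\<Sum>n\<in>{1..<i}. w n * rate n i) = a i * (\<Sum>n\<in>{1..<i}. w n * b n i)"
    by (auto simp: sum_distrib_left rate_def intro!: sum.cong)
  also have "\<dots> \<le> a i * w i"
  proof (rule mult_left_mono)
    show "(\<Sum>n\<in>{1..<i}. w n * b n i) \<le> w i"
      using mass_le[of i] weight_pos[of i] assms by (cases "i = 1") auto
  qed (use a_nonneg assms in simp)
  finally show ?thesis .
qed

lemma rate_column_split:
  assumes "1 \<le> i" "i \<le> N" and g: "\<And>n. rate n i = 0 \<Longrightarrow> g n = 0"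
  shows "(\<Sum>n\<le>N. g n) = g i + (\<Sum>n\<in>{1..<i}. g n)"
proof -
  have "(\<Sum>n\<le>N. g n) = (\<Sum>n\<in>insert i {1..<i}. g n)"
    by (rule sum.mono_neutral_right) (use assms(1,2) in \<open>auto intro!: g simp: rate_def split: if_splits\<close>)
  then show ?thesis by simp
qed

text \<open>The diagonal loses \<open>a i * w i\<close> and the entries above it regain at most that
  amount. This is the source of contractivity.\<close>

lemma rate_column_le: "i \<le> N \<Longrightarrow> (\<Sum>n\<le>N. w n * rate n i) \<le> 0"
proof (cases "i = 0")
  case True
  then show ?thesis by (auto simp: rate_def intro!: sum_nonpos)
next
  case False
  assume "i \<le> N"
  with False show ?thesis
    using rate_gain_le[of i] rate_column_split[of i N "\<lambda>n. w n * rate n i"]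
    by (simp add: rate_def[of i i] mult.commute)
qed

text \<open>Loss and gain contribute at most \<open>a i * w i\<close> each, whence the factor 2. The
  estimate makes B controlled by A.\<close>

lemma rate_column_abs_le:
  assumes "1 \<le> i" "i \<le> N"
  shows "(\<Sum>n\<le>N. w n * \<bar>rate n i\<bar>) \<le> 2 * (a i * w i)"
proof -
  have "(\<Sum>n\<le>N. w n * \<bar>rate n i\<bar>) = w i * \<bar>rate i i\<bar> + (\<Sum>n\<in>{1..<i}. w n * \<bar>rate n i\<bar>)"
    using assms by (intro rate_column_split) auto
  also have "(\<Sum>n\<in>{1..<i}. w n * \<bar>rate n i\<bar>) = (\<Sum>n\<in>{1..<i}. w n * rate n i)"
    by (intro sum.cong refl) (simp add: rate_off_diagonal_nonneg)
  also have "w i * \<bar>rate i i\<bar> = a i * w i"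
    using assms a_nonneg[of i] by (simp add: rate_def)
  finally show ?thesis using rate_gain_le[OF assms(1)] by simp
qed

section \<open>The finite systems of differential equations\<close>

lemma fin_supp_mono: "fin_supp N f \<Longrightarrow> N \<le> M \<Longrightarrow> fin_supp M f"
  by (auto simp: fin_supp_def)

lemma frag_fin_supp: "fin_supp N f \<Longrightarrow> frag f n = (\<Sum>i\<le>N. rate n i * f i)"
  unfolding frag_def fin_supp_def by (intro suminf_finite) auto

lemma frag_fin_supp_split:
  assumes "fin_supp N f" "n \<le> N"
  shows "frag f n = rate n n * f n + (\<Sum>i\<in>{n<..N}. rate n i * f i)"
proof -
  have "frag f n = (\<Sum>i\<in>insert n {n<..N}. rate n i * f i)"
    unfolding frag_fin_supp[OF assms(1)]
    by (rule sum.mono_neutral_right) (use assms(2) in \<open>auto simp: rate_def\<close>)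
  then show ?thesis by simp
qed

lemma fin_supp_frag:
  assumes "fin_supp N f"
  shows "fin_supp N (frag f)"
  unfolding fin_supp_def using assms by (auto simp: frag_fin_supp[OF assms] rate_def intro!: sum.neutral)

lemma frag_basis: "frag (basis j) n = rate n j"
  using frag_fin_supp[OF fin_supp_basis[of j j], of n]
    sum.remove[of "{..j}" j "\<lambda>i. rate n i * basis j i"]
  by (auto simp: basis_def rate_def)

text \<open>Solutions live on the whole real line, so that derivatives are two-sided even at 0 and
  translates are again solutions. Only positivity and the norm estimate are restricted to
  nonnegative times.\<close>

definition sol :: "nat \<Rightarrow> (real \<Rightarrow> seq) \<Rightarrow> bool" where
  "sol N x \<longleftrightarrow> (\<forall>t. fin_supp N (x t))
     \<and> (\<forall>t n. ((\<lambda>t. x t n) has_real_derivative frag (x t) n) (at t))"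

lemma sol_fin_supp: "sol N x \<Longrightarrow> fin_supp N (x t)"
  by (simp add: sol_def)

lemma sol_deriv: "sol N x \<Longrightarrow> ((\<lambda>t. x t n) has_real_derivative frag (x t) n) (at t)"
  by (simp add: sol_def)

lemma sol_mono: "sol N x \<Longrightarrow> N \<le> M \<Longrightarrow> sol M x"
  unfolding sol_def using fin_supp_mono by blast

lemma sol_shift: "sol N x \<Longrightarrow> sol N (\<lambda>t. x (s + t))"
  unfolding sol_def add.commute[of s] by (auto intro: DERIV_shift[THEN iffD1])

lemma sol_sum:
  assumes "finite J" "\<And>j. j \<in> J \<Longrightarrow> sol N (x j)"
  shows "sol N (\<lambda>t n. \<Sum>j\<in>J. c j * x j t n)"
  unfolding sol_def
proof (intro conjI allI)
  fix t n
  show fin: "fin_supp N (\<lambda>n. \<Sum>j\<in>J. c j * x j t n)" for t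
    using assms(2) by (auto simp: sol_def fin_supp_def intro!: sum.neutral)
  have "frag (\<lambda>n. \<Sum>j\<in>J. c j * x j t n) n = (\<Sum>j\<in>J. c j * frag (x j t) n)"
  proof -
    have "frag (\<lambda>n. \<Sum>j\<in>J. c j * x j t n) n = (\<Sum>i\<le>N. \<Sum>j\<in>J. c j * (rate n i * x j t i))"
      unfolding frag_fin_supp[OF fin] by (simp add: sum_distrib_left mult.left_commute)
    also have "\<dots> = (\<Sum>j\<in>J. c j * frag (x j t) n)"
      by (subst sum.swap) (simp add: sum_distrib_left frag_fin_supp[OF sol_fin_supp[OF assms(2)]])
    finally show ?thesis .
  qed
  then show "((\<lambda>t. \<Sum>j\<in>J. c j * x j t n) has_real_derivative frag (\<lambda>n. \<Sum>j\<in>J. c j * x j t n) n) (at t)"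
    using assms(2) by (auto intro!: DERIV_sum DERIV_cmult sol_deriv)
qed

text \<open>A linear autonomous system is also solved by the derivative of a solution. With
  uniqueness this gives the commutation \<open>semi_frag\<close>.\<close>

lemma sol_frag:
  assumes "sol N x"
  shows "sol N (\<lambda>t. frag (x t))"
  unfolding sol_def
proof (intro conjI allI)
  note fin = sol_fin_supp[OF assms]
  fix t n
  show "fin_supp N (frag (x t))" by (intro fin_supp_frag fin)
  show "((\<lambda>t. frag (x t) n) has_real_derivative frag (frag (x t)) n) (at t)"
    unfolding frag_fin_supp[OF fin, of _ n] frag_fin_supp[OF fin_supp_frag[OF fin], of _ n]
    by (intro DERIV_sum DERIV_cmult sol_deriv[OF assms])
qed

text \<open>Coordinate \<open>n\<close> satisfies a scalar linear equation forced by the coordinates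
  above it, so the system is integrated from \<open>N\<close> downwards.\<close>

lemma sol_exists:
  assumes f: "fin_supp N f"
  shows "\<exists>x. sol N x \<and> x 0 = f"
proof -
  define g where "g X n t = (\<Sum>i\<in>{n<..N}. rate n i * X i t)"
    for X :: "nat \<Rightarrow> real \<Rightarrow> real" and n t
  \<comment> \<open>The recursion demands solvability for arbitrary \<open>X\<close>, including
    discontinuous ones; the guard makes those cases vacuous and is discharged by
    \<open>cont\<close>.\<close>
  define Q where "Q n X \<longleftrightarrow> ((\<forall>i\<in>{n<..N}. \<forall>t. isCont (X i) t) \<longrightarrow>
      X n 0 = f n \<and> (\<forall>t. (X n has_real_derivative rate n n * X n t + g X n t) (at t)))" for n X
  have "\<exists>X. (\<forall>n\<le>N. Q n X) \<and> (\<forall>n>N. X n = (\<lambda>t. 0))"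
  proof (rule downward_recursion)
    fix n :: nat and X assume "n \<le> N"
    have g_upd: "g (X(n := z)) n = g X n" for z by (auto simp: g_def)
    show "\<exists>z. Q n (X(n := z))"
    proof (cases "\<forall>i\<in>{n<..N}. \<forall>t. isCont (X i) t")
      case True
      then have "\<And>t. isCont (g X n) t" unfolding g_def by (intro continuous_intros) auto
      from scalar_linear_ode[OF this, of "f n" "rate n n"] obtain z
        where "z 0 = f n \<and> (\<forall>t. (z has_real_derivative rate n n * z t + g X n t) (at t))" ..
      then have "Q n (X(n := z))" by (simp add: Q_def g_upd)
      then show ?thesis by (rule exI[of _ z])
    next
      case False
      then have "Q n (X(n := (\<lambda>t. 0)))" by (auto simp: Q_def)
      then show ?thesis by (rule exI[of _ "\<lambda>t. 0"])
    qed
  next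
    fix n and X Y :: "nat \<Rightarrow> real \<Rightarrow> real" assume eq: "\<And>i. n \<le> i \<Longrightarrow> X i = Y i" and "Q n X"
    have "g X n = g Y n" using eq by (auto simp: g_def)
    with \<open>Q n X\<close> show "Q n Y" using eq by (simp add: Q_def)
  qed
  then obtain X where X: "\<And>n. n \<le> N \<Longrightarrow> Q n X" "\<And>n. N < n \<Longrightarrow> X n = (\<lambda>t. 0)" by blast
  have cont: "\<forall>t. isCont (X n) t" for n
  proof (induction n rule: downward_induct[of N])
    case (above n)
    then show ?case by (simp add: X)
  next
    case (step n)
    then have "\<forall>t. (X n has_real_derivative rate n n * X n t + g X n t) (at t)"
      using X(1)[of n] by (simp add: Q_def)
    then show ?case using DERIV_isCont by blast
  qed
  have init: "X n 0 = f n" and deriv: "(X n has_real_derivative rate n n * X n t + g X n t) (at t)"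
    if "n \<le> N" for n t
    using X(1)[OF that] cont by (simp_all add: Q_def)
  \<comment> \<open>Row 0 of the matrix vanishes, so the dummy coordinate stays at its initial value
    0.\<close>
  have "X 0 t = X 0 0" for t
    by (rule DERIV_isconst_all) (use deriv[of 0] in \<open>simp add: g_def rate_def\<close>)
  then have X0: "X 0 t = 0" for t using init[of 0] f by (simp add: fin_supp_def)
  have fin: "fin_supp N (\<lambda>n. X n t)" for t using X0 X(2) by (simp add: fin_supp_def)
  have "sol N (\<lambda>t n. X n t)"
    unfolding sol_def
  proof (intro conjI allI fin)
    fix t n
    show "(X n has_real_derivative frag (\<lambda>n. X n t) n) (at t)"
    proof (cases "n \<le> N")
      case True
      then show ?thesis using deriv[OF True] by (simp add: frag_fin_supp_split[OF fin] g_def)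
    next
      case False
      then show ?thesis using X(2)[of n] fin_supp_frag[OF fin, of t] by (simp add: fin_supp_def)
    qed
  qed
  moreover have "(\<lambda>n. X n 0) = f"
  proof
    show "X n 0 = f n" for n using init[of n] X(2)[of n] f
      by (cases "n \<le> N") (auto simp: fin_supp_def)
  qed
  ultimately show ?thesis by (intro exI[of _ "\<lambda>t n. X n t"]) simp
qed

text \<open>The factor removes the diagonal term and leaves only nonnegative coefficients. Knowing
  the higher coordinates then determines the sign, or the vanishing, of this derivative.\<close>

lemma sol_integrating_factor:
  assumes "sol N x" "n \<le> N"
  shows "((\<lambda>t. exp (- (rate n n * t)) * x t n) has_real_derivative
      exp (- (rate n n * t)) * (\<Sum>i\<in>{n<..N}. rate n i * x t i)) (at t)"
  by (rule derivative_eq_intros refl sol_deriv[OF assms(1)])+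
    (simp add: frag_fin_supp_split[OF sol_fin_supp[OF assms(1)] assms(2)] algebra_simps)

lemma sol_zero:
  assumes "sol N x" "x 0 = (\<lambda>n. 0)"
  shows "\<forall>t. x t n = 0"
proof (induction n rule: downward_induct[of N])
  case (above n)
  then show ?case using sol_fin_supp[OF assms(1)] by (simp add: fin_supp_def)
next
  case (step n)
  show ?case
  proof
    fix t
    have "exp (- (rate n n * t)) * x t n = exp (- (rate n n * 0)) * x 0 n"
      by (rule DERIV_isconst_all)
        (use sol_integrating_factor[OF assms(1) step(1)] step(2) in simp)
    then show "x t n = 0" using assms(2) by simp
  qed
qed

lemma sol_unique:
  assumes "sol N x" "sol N y" "x 0 = y 0"
  shows "x = y"
proof -
  \<comment> \<open>The difference is written as a two-term linear combination so that
    \<open>sol_sum\<close> applies.\<close>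
  have "sol N (\<lambda>t n. \<Sum>j\<in>{True, False}. (if j then 1 else - 1) * (if j then x else y) t n)"
    by (rule sol_sum) (use assms in auto)
  then have "sol N (\<lambda>t n. x t n - y t n)" by (simp add: insert_commute)
  from sol_zero[OF this] assms(3) show ?thesis by (simp add: fun_eq_iff)
qed

lemma sol_nonneg:
  assumes "sol N x" "\<And>n. 0 \<le> x 0 n"
  shows "\<forall>t\<ge>0. 0 \<le> x t n"
proof (induction n rule: downward_induct[of N])
  case (above n)
  then show ?case using sol_fin_supp[OF assms(1)] by (simp add: fin_supp_def)
next
  case (step n)
  show ?case
  proof (intro allI impI)
    fix t :: real assume "0 \<le> t"
    have "exp (- (rate n n * 0)) * x 0 n \<le> exp (- (rate n n * t)) * x t n"
    proof (rule DERIV_nonneg_imp_nondecreasing[OF \<open>0 \<le> t\<close>])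
      fix s :: real assume "0 \<le> s"
      then have "0 \<le> (\<Sum>i\<in>{n<..N}. rate n i * x s i)"
        using step(2) by (intro sum_nonneg mult_nonneg_nonneg rate_off_diagonal_nonneg) auto
      then show "\<exists>y. ((\<lambda>t. exp (- (rate n n * t)) * x t n) has_real_derivative y) (at s) \<and> 0 \<le> y"
        by (intro exI[of _ "exp (- (rate n n * s)) * (\<Sum>i\<in>{n<..N}. rate n i * x s i)"] conjI
            sol_integrating_factor[OF assms(1) step(1)]) simp
    qed
    then have "0 \<le> exp (- (rate n n * t)) * x t n" using assms(2)[of n] by simp
    then show "0 \<le> x t n" by (simp add: zero_le_mult_iff)
  qed
qed

lemma sol_wnorm_le:
  assumes "sol N x" "\<And>n. 0 \<le> x 0 n" "0 \<le> t"
  shows "wnorm w (x t) \<le> wnorm w (x 0)"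
proof -
  note fin = sol_fin_supp[OF assms(1)]
  have nonneg: "0 \<le> x s n" if "0 \<le> s" for s n using sol_nonneg[OF assms(1,2)] that by simp
  have norm: "wnorm w (x s) = (\<Sum>n\<le>N. w n * x s n)" if "0 \<le> s" for s
    unfolding fin_supp_wnorm[OF fin] by (simp add: nonneg that)
  have "(\<Sum>n\<le>N. w n * x t n) \<le> (\<Sum>n\<le>N. w n * x 0 n)"
  proof (rule DERIV_nonpos_imp_nonincreasing[OF assms(3)])
    fix s :: real assume s: "0 \<le> s"
    have "((\<lambda>t. \<Sum>n\<le>N. w n * x t n) has_real_derivative (\<Sum>n\<le>N. w n * frag (x s) n)) (at s)"
      by (intro DERIV_sum DERIV_cmult sol_deriv[OF assms(1)])
    \<comment> \<open>Exchanging the sums brings out the weighted column sums of the matrix, with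
      the nonnegative coordinates as coefficients.\<close>
    moreover have "(\<Sum>n\<le>N. w n * frag (x s) n) = (\<Sum>i\<le>N. x s i * (\<Sum>n\<le>N. w n * rate n i))"
      unfolding frag_fin_supp[OF fin] sum_distrib_left by (subst sum.swap) (simp add: mult_ac)
    moreover have "\<dots> \<le> 0"
      by (intro sum_nonpos mult_nonneg_nonpos nonneg s rate_column_le) simp
    ultimately show "\<exists>y. ((\<lambda>t. \<Sum>n\<le>N. w n * x t n) has_real_derivative y) (at s) \<and> y \<le> 0"
      by auto
  qed
  then show ?thesis using norm assms(3) by simp
qed

section \<open>The kernel and its semigroup\<close>

definition kern :: "nat \<Rightarrow> real \<Rightarrow> seq" where
  "kern j = (SOME x. sol j x \<and> x 0 = basis j)"

text \<open>\<open>kern j t n\<close> is the entry in row \<open>n\<close> and column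
  \<open>j\<close> of the exponential of \<open>t\<close> times the matrix. For general
  \<open>f\<close> the series is controlled only when \<open>t\<close> is nonnegative; for finitely
  supported \<open>f\<close> it is a finite sum and gives the solution at every real time.\<close>

definition semi :: "real \<Rightarrow> seq \<Rightarrow> seq" where
  "semi t f = (\<lambda>n. \<Sum>j. f j * kern j t n)"

lemma sol_kern: "sol j (kern j)" and kern_0: "kern j 0 = basis j"
  using someI_ex[OF sol_exists[OF fin_supp_basis[of j j, OF order_refl]]] by (simp_all add: kern_def)

lemma kern_nonneg: "0 \<le> t \<Longrightarrow> 0 \<le> kern j t n"
  using sol_nonneg[OF sol_kern] by (simp add: kern_0 basis_def)

lemma kern_ell1: "kern j t \<in> ell1 w"
  by (rule fin_supp_ell1[OF sol_fin_supp[OF sol_kern]])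

lemma kern_term_le:
  assumes "f \<in> ell1 w" "0 \<le> t"
  shows "wnorm w (\<lambda>n. f j * kern j t n) \<le> w j * \<bar>f j\<bar>"
proof (cases "j = 0")
  case False
  have "wnorm w (kern j t) \<le> wnorm w (basis j)"
    using sol_wnorm_le[OF sol_kern _ assms(2), of j] by (simp add: kern_0 basis_def)
  then show ?thesis
    using False by (simp add: wnorm_scale[OF kern_ell1] wnorm_basis mult.commute[of "w j"] mult_left_mono)
qed (use assms in \<open>simp add: ell1_def\<close>)

lemma
  assumes "f \<in> ell1 w" "0 \<le> t"
  shows semi_summable: "summable (\<lambda>j. f j * kern j t n)"
    and semi_ell1: "semi t f \<in> ell1 w"
    and semi_contraction: "wnorm w (semi t f) \<le> wnorm w f"
proof -
  have "(\<lambda>n. f j * kern j t n) \<in> ell1 w" for j by (rule ell1_scale[OF kern_ell1])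
  note ser = ell1_series[of "\<lambda>j n. f j * kern j t n", OF this kern_term_le[OF assms] ell1_summable[OF assms(1)]]
  show "summable (\<lambda>j. f j * kern j t n)" by (rule ser(1))
  show "semi t f \<in> ell1 w" unfolding semi_def by (rule ser(2))
  show "wnorm w (semi t f) \<le> wnorm w f" unfolding semi_def wnorm_def[of w f] by (rule ser(3))
qed

lemma semi_bounded_op: "0 \<le> t \<Longrightarrow> bounded_op w (semi t)"
  unfolding bounded_op_def
proof (intro conjI ballI allI exI[of _ 1])
  fix f g and c :: real assume t: "0 \<le> t" and f: "f \<in> ell1 w"
  show "semi t f \<in> ell1 w" by (rule semi_ell1[OF f t])
  show "wnorm w (semi t f) \<le> 1 * wnorm w f" using semi_contraction[OF f t] by simp
  show "semi t (\<lambda>n. c * f n) = (\<lambda>n. c * semi t f n)"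
    using suminf_mult[OF semi_summable[OF f t], of c] by (simp add: semi_def mult.assoc)
  assume g: "g \<in> ell1 w"
  show "semi t (\<lambda>n. f n + g n) = (\<lambda>n. semi t f n + semi t g n)"
    using suminf_add[OF semi_summable[OF f t] semi_summable[OF g t]]
      by (simp add: semi_def distrib_right)
qed

lemma semi_fin_supp:
  assumes "fin_supp N f"
  shows "semi t f n = (\<Sum>j\<le>N. f j * kern j t n)"
  unfolding semi_def using assms by (intro suminf_finite) (auto simp: fin_supp_def)

lemma semi_eq_sol:
  assumes "fin_supp N f" "sol N x" "x 0 = f"
  shows "semi t f = x t"
proof -
  have *: "semi s f = (\<lambda>n. \<Sum>j\<le>N. f j * kern j s n)" for s
    by (rule ext) (rule semi_fin_supp[OF assms(1)])
  have "sol N (\<lambda>t. semi t f)"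
    unfolding * by (rule sol_sum) (auto intro: sol_mono[OF sol_kern])
  moreover have "semi 0 f = f"
    by (rule ext) (simp add: * kern_0 fin_supp_expand[OF assms(1)])
  ultimately have "(\<lambda>t. semi t f) = x"
    by (intro sol_unique[OF _ assms(2)]) (simp_all add: assms(3))
  then show ?thesis by (simp add: fun_eq_iff)
qed

lemma
  assumes "fin_supp N f"
  shows semi_sol: "sol N (\<lambda>t. semi t f)"
    and semi_0_fin_supp: "semi 0 f = f"
    and semi_frag: "semi t (frag f) = frag (semi t f)"
proof -
  obtain x where x: "sol N x" "x 0 = f" using sol_exists[OF assms] by blast
  have eq: "semi t f = x t" for t by (rule semi_eq_sol[OF assms x])
  show "sol N (\<lambda>t. semi t f)" "semi 0 f = f" using x by (simp_all add: eq)
  show "semi t (frag f) = frag (semi t f)"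
    unfolding eq by (rule semi_eq_sol[OF fin_supp_frag[OF assms] sol_frag[OF x(1)]]) (simp add: x)
qed

lemma semi_add_fin_supp:
  assumes "fin_supp N f"
  shows "semi (s + t) f = semi s (semi t f)"
proof -
  have "semi s (semi t f) = (\<lambda>s. semi (t + s) f) s"
    using semi_eq_sol[OF sol_fin_supp[OF semi_sol[OF assms]] sol_shift[OF semi_sol[OF assms]]] by simp
  then show ?thesis by (simp add: add.commute)
qed

text \<open>The algebraic laws are checked on unit vectors. For strong continuity \<open>f\<close>
  is replaced by a truncation, whose orbit moves in finitely many coordinates, each continuous in
  time; contractivity carries the small error along.\<close>

lemma semi_C0: "C0_semigroup w semi"
  unfolding C0_semigroup_def
proof (intro conjI ballI allI impI)
  fix f assume f: "f \<in> ell1 w"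
  have id: "bounded_op w (\<lambda>f. f)" by (auto simp: bounded_op_def intro!: exI[of _ 1])
  show "semi 0 f = f"
    by (rule bounded_op_eqI[OF semi_bounded_op id _ f])
      (simp_all add: semi_0_fin_supp[OF fin_supp_basis[OF order_refl]])
  show "semi (s + t) f = semi s (semi t f)" if "0 \<le> s" "0 \<le> t" for s t
    by (rule bounded_op_eqI[OF semi_bounded_op bounded_op_compose[OF semi_bounded_op semi_bounded_op] _ f])
      (use that in \<open>simp_all add: semi_add_fin_supp[OF fin_supp_basis[OF order_refl]]\<close>)
  show "((\<lambda>t. wnorm w (\<lambda>n. semi t f n - f n)) \<longlongrightarrow> 0) (at_right 0)"
  proof (rule order_tendstoI)
    fix e :: real assume "e < 0"
    then have "e < wnorm w (\<lambda>n. semi t f n - f n)" if "0 < t" for t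
      using wnorm_nonneg[OF ell1_diff[OF semi_ell1[OF f] f], of t] that by linarith
    then show "\<forall>\<^sub>F t in at_right 0. e < wnorm w (\<lambda>n. semi t f n - f n)"
      by (rule eventually_mono[OF eventually_at_right_less])
  next
    fix e :: real assume e: "0 < e"
    have "\<forall>\<^sub>F N in sequentially. wnorm w (\<lambda>n. trunc N f n - f n) < e / 3"
      using e by (intro order_tendstoD(2)[OF trunc_tendsto[OF f]]) simp
    then obtain N where N: "wnorm w (\<lambda>n. trunc N f n - f n) < e / 3"
      using eventually_happens'[OF sequentially_bot] by blast
    define h where "h = trunc N f"
    have fin: "fin_supp N h" unfolding h_def by (rule fin_supp_trunc[OF f])
    have h: "h \<in> ell1 w" by (rule fin_supp_ell1[OF fin])
    have "((\<lambda>t. semi t h n) \<longlongrightarrow> semi 0 h n) (at_right 0)" for n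
      by (rule tendsto_within_subset[OF DERIV_isCont[OF sol_deriv[OF semi_sol[OF fin]], unfolded isCont_def] subset_UNIV])
    then have "((\<lambda>t. \<Sum>n\<le>N. w n * \<bar>semi t h n - h n\<bar>) \<longlongrightarrow> (\<Sum>n\<le>N. w n * \<bar>semi 0 h n - h n\<bar>)) (at_right 0)"
      by (intro tendsto_intros)
    then have "((\<lambda>t. \<Sum>n\<le>N. w n * \<bar>semi t h n - h n\<bar>) \<longlongrightarrow> 0) (at_right 0)"
      by (simp add: semi_0_fin_supp[OF fin])
    then have "\<forall>\<^sub>F t in at_right 0. (\<Sum>n\<le>N. w n * \<bar>semi t h n - h n\<bar>) < e / 3"
      by (rule order_tendstoD(2)) (use e in simp)
    then show "\<forall>\<^sub>F t in at_right 0. wnorm w (\<lambda>n. semi t f n - f n) < e"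
      using eventually_at_right_less[of 0]
    proof eventually_elim
      case (elim t)
      then have t: "0 \<le> t" by simp
      have finD: "fin_supp N (\<lambda>n. semi t h n - h n)"
        using sol_fin_supp[OF semi_sol[OF fin], of t] fin by (simp add: fin_supp_def)
      have "wnorm w (\<lambda>n. semi t f n - f n)
          \<le> wnorm w (\<lambda>n. semi t f n - semi t h n) + wnorm w (\<lambda>n. semi t h n - f n)"
        by (intro wnorm_triangle semi_ell1 f h t)
      also have "wnorm w (\<lambda>n. semi t f n - semi t h n) \<le> wnorm w (\<lambda>n. f n - h n)"
        unfolding bounded_op_diff[OF semi_bounded_op[OF t] f h, symmetric]
        by (intro semi_contraction ell1_diff f h t)
      also have "wnorm w (\<lambda>n. f n - h n) < e / 3" unfolding h_def using N
        by (simp add: wnorm_minus_commute)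
      also have "wnorm w (\<lambda>n. semi t h n - f n)
          \<le> wnorm w (\<lambda>n. semi t h n - h n) + wnorm w (\<lambda>n. h n - f n)"
        by (intro wnorm_triangle semi_ell1 f h t)
      also have "wnorm w (\<lambda>n. h n - f n) < e / 3" unfolding h_def by (rule N)
      also have "wnorm w (\<lambda>n. semi t h n - h n) < e / 3" unfolding fin_supp_wnorm[OF finD] using elim
        by simp
      finally show ?case by simp
    qed
  qed
qed (rule semi_bounded_op)

end

section \<open>The generator\<close>

context ell1_weight
begin

lemma generator_ell1: "(f, g) \<in> generator w S \<Longrightarrow> f \<in> ell1 w" "(f, g) \<in> generator w S \<Longrightarrow> g \<in> ell1 w"
  by (simp_all add: generator_def)

lemma C0_quotient_ell1:
  assumes "C0_semigroup w S" "0 < t" "f \<in> ell1 w" "g \<in> ell1 w"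
  shows "(\<lambda>n. (S t f n - f n) / t - g n) \<in> ell1 w"
proof -
  have "(\<lambda>n. (1 / t) * (S t f n - f n)) \<in> ell1 w"
    using bounded_op_ell1[OF C0_bounded_op[OF assms(1)]] assms by (intro ell1_scale ell1_diff) auto
  from ell1_diff[OF this assms(4)] show ?thesis by simp
qed

lemma generator_diff:
  assumes S: "C0_semigroup w S" and 1: "(f, g) \<in> generator w S" and 2: "(f', g') \<in> generator w S"
  shows "(\<lambda>n. f n - f' n, \<lambda>n. g n - g' n) \<in> generator w S"
proof -
  note ell = generator_ell1[OF 1] generator_ell1[OF 2]
  define q where "q f g t = (\<lambda>n. (S t f n - f n) / t - g n)" for f g :: seq and t
  have q_ell: "q f g t \<in> ell1 w" if "0 < t" "f \<in> ell1 w" "g \<in> ell1 w" for t f g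
    unfolding q_def by (rule C0_quotient_ell1[OF S that])
  define D where "D t = q (\<lambda>n. f n - f' n) (\<lambda>n. g n - g' n) t" for t
  have bound: "norm (wnorm w (D t)) \<le> wnorm w (q f g t) + wnorm w (q f' g' t)" if t: "0 < t" for t
  proof -
    have "D t = (\<lambda>n. q f g t n - q f' g' t n)"
      unfolding D_def q_def bounded_op_diff[OF C0_bounded_op[OF S less_imp_le[OF t]] ell(1,3)]
      by (simp add: diff_divide_distrib add_divide_distrib algebra_simps)
    then show ?thesis
      using wnorm_diff[OF q_ell[OF t ell(1,2)] q_ell[OF t ell(3,4)]]
        wnorm_nonneg[OF ell1_diff[OF q_ell[OF t ell(1,2)] q_ell[OF t ell(3,4)]]] by simp
  qed
  have "((\<lambda>t. wnorm w (q f g t) + wnorm w (q f' g' t)) \<longlongrightarrow> 0 + 0) (at_right 0)"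
    using 1 2 unfolding q_def by (intro tendsto_add) (simp_all add: generator_def)
  then have "((\<lambda>t. wnorm w (D t)) \<longlongrightarrow> 0) (at_right 0)"
    by (intro Lim_null_comparison[OF eventually_mono[OF eventually_at_right_less bound]]) simp_all
  then show ?thesis
    unfolding generator_def D_def q_def using ell by (simp add: ell1_diff)
qed

text \<open>Up to the vanishing error \<open>q t\<close>, \<open>f - g\<close> equals
  \<open>(1 + 1/t) f - (1/t) S t f\<close>, whose norm is at least that of \<open>f\<close> because
  \<open>S t\<close> does not increase it.\<close>

lemma contraction_generator_dissipative:
  assumes S: "C0_semigroup w S" and contr: "\<And>t. 0 \<le> t \<Longrightarrow> wnorm w (S t f) \<le> wnorm w f"
    and fg: "(f, g) \<in> generator w S"
  shows "wnorm w f \<le> wnorm w (\<lambda>n. f n - g n)"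
proof -
  note ell = generator_ell1[OF fg]
  define q where "q t = (\<lambda>n. (S t f n - f n) / t - g n)" for t
  have bound: "wnorm w f \<le> wnorm w (\<lambda>n. f n - g n) + wnorm w (q t)" if t: "0 < t" for t
  proof -
    have St: "S t f \<in> ell1 w" using bounded_op_ell1[OF C0_bounded_op[OF S]] ell t by simp
    have qt: "q t \<in> ell1 w" unfolding q_def by (rule C0_quotient_ell1[OF S t ell])
    have "wnorm w (\<lambda>n. (1 + 1/t) * f n) - wnorm w (\<lambda>n. (1/t) * S t f n)
        \<le> wnorm w (\<lambda>n. (1 + 1/t) * f n - (1/t) * S t f n)"
      by (intro wnorm_reverse_triangle ell1_scale ell St)
    also have "(\<lambda>n. (1 + 1/t) * f n - (1/t) * S t f n) = (\<lambda>n. (f n - g n) - q t n)"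
      by (simp add: q_def diff_divide_distrib algebra_simps)
    also have "wnorm w \<dots> \<le> wnorm w (\<lambda>n. f n - g n) + wnorm w (q t)"
      by (intro wnorm_diff ell1_diff ell qt)
    finally have "(1 + 1/t) * wnorm w f - (1/t) * wnorm w (S t f) \<le> wnorm w (\<lambda>n. f n - g n) + wnorm w (q t)"
      using t by (simp add: wnorm_scale ell St del: times_divide_eq_left)
    moreover have "(1/t) * wnorm w (S t f) \<le> (1/t) * wnorm w f"
      using t contr by (intro mult_left_mono) auto
    ultimately show ?thesis by (simp add: distrib_right)
  qed
  have "((\<lambda>t. wnorm w (\<lambda>n. f n - g n) + wnorm w (q t)) \<longlongrightarrow> wnorm w (\<lambda>n. f n - g n) + 0) (at_right 0)"
    using fg unfolding q_def by (intro tendsto_intros) (simp add: generator_def)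
  from tendsto_lowerbound[OF this eventually_mono[OF eventually_at_right_less bound]]
  show ?thesis by simp
qed

end

section \<open>A + B, its closure and the comparison with the generator\<close>

context frag_system
begin

text \<open>The columns of the matrix, multiplied by the coordinates of \<open>f\<close>, form an
  absolutely convergent series by \<open>rate_column_abs_le\<close>. The three claims concern its
  coordinates, its sum and its tails.\<close>

lemma
  assumes f: "f \<in> ell1 w" and af: "(\<lambda>n. a n * f n) \<in> ell1 w"
  shows frag_summable: "summable (\<lambda>i. rate n i * f i)"
    and frag_ell1: "frag f \<in> ell1 w"
    and frag_trunc_tendsto: "(\<lambda>N. wnorm w (\<lambda>n. frag (trunc N f) n - frag f n)) \<longlonglongrightarrow> 0"
proof -
  define F where "F i = (\<lambda>n. f i * rate n i)" for i
  define c where "c i = 2 * (w i * \<bar>a i * f i\<bar>)" for i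
  have Ffin: "fin_supp i (F i)" for i by (auto simp: fin_supp_def F_def rate_def)
  have F: "F i \<in> ell1 w" for i by (rule fin_supp_ell1[OF Ffin])
  have le: "wnorm w (F i) \<le> c i" for i
  proof (cases "i = 0")
    case True
    then show ?thesis using f by (simp add: F_def c_def ell1_def)
  next
    case False
    have "wnorm w (F i) = \<bar>f i\<bar> * (\<Sum>n\<le>i. w n * \<bar>rate n i\<bar>)"
      unfolding fin_supp_wnorm[OF Ffin] by (simp add: F_def abs_mult sum_distrib_left mult_ac)
    also have "\<dots> \<le> \<bar>f i\<bar> * (2 * (a i * w i))"
      using False by (intro mult_left_mono rate_column_abs_le) auto
    also have "\<dots> = c i" using False a_nonneg[of i] by (simp add: c_def abs_mult)
    finally show ?thesis .
  qed
  have c: "summable c" unfolding c_def by (intro summable_mult ell1_summable[OF af])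
  note ser = ell1_series[of F, OF F le c]
  have frag: "frag f = (\<lambda>n. \<Sum>i. F i n)" by (simp add: frag_def F_def mult.commute)
  show smm: "summable (\<lambda>i. rate n i * f i)" for n using ser(1)[of n]
    by (simp add: F_def mult.commute)
  show "frag f \<in> ell1 w" unfolding frag by (rule ser)
  have bound: "norm (wnorm w (\<lambda>n. frag (trunc N f) n - frag f n)) \<le> (\<Sum>i. c (i + Suc N))"
    for N
  proof -
    have "frag f n - frag (trunc N f) n = (\<Sum>i. F (i + Suc N) n)" for n
    proof -
      have "frag (trunc N f) n = (\<Sum>i\<le>N. F i n)"
        unfolding frag_fin_supp[OF fin_supp_trunc[OF f]] by (simp add: trunc_def F_def mult.commute)
      then show ?thesis
        using suminf_split_initial_segment[OF ser(1), of n "Suc N"]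
          by (simp add: frag lessThan_Suc_atMost)
    qed
    moreover have "wnorm w (\<lambda>n. \<Sum>i. F (i + Suc N) n) \<le> (\<Sum>i. c (i + Suc N))"
      by (rule ell1_series(3)) (use F le summable_ignore_initial_segment[OF c, of "Suc N"] in auto)
    moreover have "0 \<le> wnorm w (\<lambda>n. \<Sum>i. F (i + Suc N) n)"
      by (intro wnorm_nonneg ell1_series(2)[of "\<lambda>i. F (i + Suc N)" "\<lambda>i. c (i + Suc N)"])
        (use F le summable_ignore_initial_segment[OF c, of "Suc N"] in auto)
    ultimately show ?thesis by (simp add: wnorm_minus_commute[of "frag (trunc N f)"])
  qed
  have "(\<lambda>N. \<Sum>i. c (i + Suc N)) \<longlonglongrightarrow> 0"
    by (rule LIMSEQ_Suc[OF suminf_exist_split2[OF c]])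
  then show "(\<lambda>N. wnorm w (\<lambda>n. frag (trunc N f) n - frag f n)) \<longlonglongrightarrow> 0"
    by (rule Lim_null_comparison[OF always_eventually[OF allI[OF bound]]])
qed

lemma frag_eq_A_plus_B:
  assumes f: "f \<in> ell1 w" and af: "(\<lambda>n. a n * f n) \<in> ell1 w"
  shows "1 \<le> n \<Longrightarrow> summable (\<lambda>k. a (n + 1 + k) * b n (n + 1 + k) * f (n + 1 + k))"
    and "frag f = (\<lambda>n. - a n * f n + B_seq a b f n)"
proof -
  note smm = frag_summable[OF f af]
  have row: "rate n (i + Suc n) * f (i + Suc n) = a (n + 1 + i) * b n (n + 1 + i) * f (n + 1 + i)"
    if "1 \<le> n" for n i using that by (simp add: rate_def add.commute)
  show "summable (\<lambda>k. a (n + 1 + k) * b n (n + 1 + k) * f (n + 1 + k))" if "1 \<le> n"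
    using summable_ignore_initial_segment[OF smm[of n], of "Suc n"] unfolding row[OF that] .
  show "frag f = (\<lambda>n. - a n * f n + B_seq a b f n)"
  proof
    fix n
    show "frag f n = - a n * f n + B_seq a b f n"
    proof (cases "n = 0")
      case True
      then show ?thesis using f by (simp add: frag_def rate_def B_seq_def ell1_def)
    next
      case False
      have "frag f n = (\<Sum>i. rate n (i + Suc n) * f (i + Suc n)) + (\<Sum>i<Suc n. rate n i * f i)"
        unfolding frag_def by (rule suminf_split_initial_segment[OF smm])
      also have "(\<Sum>i<Suc n. rate n i * f i) = - a n * f n"
        using False by (simp add: rate_def)
      also have "(\<Sum>i. rate n (i + Suc n) * f (i + Suc n)) = B_seq a b f n"
        using False by (simp add: row B_seq_def del: add_Suc_right)
      finally show ?thesis by simp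
    qed
  qed
qed

text \<open>The domain of A lies in that of B, so the conditions in \<open>op_B\<close> hold
  automatically on it.\<close>

lemma op_sum_iff:
  "(f, g) \<in> op_sum (op_A w a) (op_B w a b)
    \<longleftrightarrow> f \<in> ell1 w \<and> (\<lambda>n. a n * f n) \<in> ell1 w \<and> g = frag f" (is "?L \<longleftrightarrow> ?R")
proof
  assume ?L
  then show ?R using frag_eq_A_plus_B(2)[of f] by (auto simp: op_sum_def op_A_def op_B_def)
next
  assume R: ?R
  then have f: "f \<in> ell1 w" and af: "(\<lambda>n. a n * f n) \<in> ell1 w" by auto
  have "B_seq a b f = (\<lambda>n. frag f n + a n * f n)" by (simp add: frag_eq_A_plus_B(2)[OF f af])
  then have "B_seq a b f \<in> ell1 w" using ell1_add[OF frag_ell1[OF f af] af] by simp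
  then have B: "(f, B_seq a b f) \<in> op_B w a b"
    using frag_eq_A_plus_B(1)[OF f af] f by (auto simp: op_B_def)
  have A: "(f, \<lambda>n. - a n * f n) \<in> op_A w a" using f af by (auto simp: op_A_def)
  have g: "g = (\<lambda>n. - a n * f n + B_seq a b f n)" using R frag_eq_A_plus_B(2)[OF f af] by simp
  show ?L
    unfolding op_sum_def g
    by (intro CollectI exI[of _ f] exI[of _ "\<lambda>n. - a n * f n"] exI[of _ "B_seq a b f"] conjI refl A B)
qed

lemma fin_supp_in_op_sum: "fin_supp N h \<Longrightarrow> (h, frag h) \<in> op_sum (op_A w a) (op_B w a b)"
  unfolding op_sum_iff by (auto intro!: fin_supp_ell1[of N] simp: fin_supp_def)

text \<open>The graph closure of \<open>frag\<close> restricted to finitely supported sequences. It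
  is the common meeting point of \<open>op_G\<close> and the generator.\<close>

definition core_limit :: "seq \<Rightarrow> seq \<Rightarrow> bool" where
  "core_limit f g \<longleftrightarrow> f \<in> ell1 w \<and> g \<in> ell1 w \<and>
     (\<forall>e>0. \<exists>N h. fin_supp N h \<and> wnorm w (\<lambda>n. h n - f n) < e \<and> wnorm w (\<lambda>n. frag h n - g n) < e)"

lemma core_limit_fin_supp: "fin_supp N h \<Longrightarrow> core_limit h (frag h)"
  unfolding core_limit_def
  by (auto intro!: fin_supp_ell1 fin_supp_frag exI[of _ N] exI[of _ h])

lemma op_sum_core_limit:
  assumes "(f, g) \<in> op_sum (op_A w a) (op_B w a b)"
  shows "core_limit f g"
proof -
  from assms have f: "f \<in> ell1 w" and af: "(\<lambda>n. a n * f n) \<in> ell1 w" and g: "g = frag f"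
    by (auto simp: op_sum_iff)
  have "\<exists>N h. fin_supp N h \<and> wnorm w (\<lambda>n. h n - f n) < e \<and> wnorm w (\<lambda>n. frag h n - g n) < e"
    if "0 < e" for e
  proof -
    have "\<forall>\<^sub>F N in sequentially. wnorm w (\<lambda>n. trunc N f n - f n) < e
        \<and> wnorm w (\<lambda>n. frag (trunc N f) n - g n) < e"
      unfolding g by (intro eventually_conj order_tendstoD(2)[OF trunc_tendsto[OF f] that]
          order_tendstoD(2)[OF frag_trunc_tendsto[OF f af] that])
    then obtain N where "wnorm w (\<lambda>n. trunc N f n - f n) < e" "wnorm w (\<lambda>n. frag (trunc N f) n - g n) < e"
      using eventually_happens'[OF sequentially_bot] by blast
    then show ?thesis using fin_supp_trunc[OF f, of N] by blast
  qed
  then show ?thesis unfolding core_limit_def using f frag_ell1[OF f af] g by simp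
qed

text \<open>Truncation approximates every element of the graph of A + B by finitely supported ones,
  and these lie in that graph themselves; so both closures coincide.\<close>

lemma op_G_iff: "(f, g) \<in> op_G w a b \<longleftrightarrow> core_limit f g"
proof
  assume "(f, g) \<in> op_G w a b"
  then obtain F G where f: "f \<in> ell1 w" and g: "g \<in> ell1 w"
    and FG: "\<And>k::nat. (F k, G k) \<in> op_sum (op_A w a) (op_B w a b)"
    and lim: "(\<lambda>k. wnorm w (\<lambda>n. F k n - f n)) \<longlonglongrightarrow> 0" "(\<lambda>k. wnorm w (\<lambda>n. G k n - g n)) \<longlonglongrightarrow> 0"
    unfolding op_G_def op_closure_def by blast
  have "\<exists>N h. fin_supp N h \<and> wnorm w (\<lambda>n. h n - f n) < e \<and> wnorm w (\<lambda>n. frag h n - g n) < e"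
    if "0 < e" for e
  proof -
    have e2: "0 < e / 2" using that by simp
    have "\<forall>\<^sub>F k in sequentially. wnorm w (\<lambda>n. F k n - f n) < e / 2 \<and> wnorm w (\<lambda>n. G k n - g n) < e / 2"
      by (intro eventually_conj order_tendstoD(2)[OF lim(1) e2] order_tendstoD(2)[OF lim(2) e2])
    then obtain k where k: "wnorm w (\<lambda>n. F k n - f n) < e / 2" "wnorm w (\<lambda>n. G k n - g n) < e / 2"
      using eventually_happens'[OF sequentially_bot] by blast
    obtain N h where h: "fin_supp N h" "wnorm w (\<lambda>n. h n - F k n) < e / 2" "wnorm w (\<lambda>n. frag h n - G k n) < e / 2"
      and FGk: "F k \<in> ell1 w" "G k \<in> ell1 w"
      using op_sum_core_limit[OF FG[of k]] e2 unfolding core_limit_def by blast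
    have "wnorm w (\<lambda>n. h n - f n) < e"
      using wnorm_triangle[OF fin_supp_ell1[OF h(1)] FGk(1) f] h(2) k(1) by linarith
    moreover have "wnorm w (\<lambda>n. frag h n - g n) < e"
      using wnorm_triangle[OF fin_supp_ell1[OF fin_supp_frag[OF h(1)]] FGk(2) g] h(3) k(2) by linarith
    ultimately show ?thesis using h(1) by blast
  qed
  then show "core_limit f g" using f g by (simp add: core_limit_def)
next
  assume fg: "core_limit f g"
  then have ell: "f \<in> ell1 w" "g \<in> ell1 w" by (simp_all add: core_limit_def)
  have "\<forall>k::nat. \<exists>h. (\<exists>N. fin_supp N h) \<and> wnorm w (\<lambda>n. h n - f n) < inverse (real (Suc k))
      \<and> wnorm w (\<lambda>n. frag h n - g n) < inverse (real (Suc k))"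
    using fg unfolding core_limit_def
      by (metis inverse_positive_iff_positive of_nat_0_less_iff zero_less_Suc)
  then obtain H where H: "\<forall>k::nat. (\<exists>N. fin_supp N (H k)) \<and> wnorm w (\<lambda>n. H k n - f n) < inverse (real (Suc k))
      \<and> wnorm w (\<lambda>n. frag (H k) n - g n) < inverse (real (Suc k))"
    unfolding choice_iff ..
  have HF: "H k \<in> ell1 w" "frag (H k) \<in> ell1 w" for k
    using H fin_supp_ell1 fin_supp_frag by blast+
  have "norm (wnorm w (\<lambda>n. H k n - f n)) \<le> inverse (real (Suc k))"
    "norm (wnorm w (\<lambda>n. frag (H k) n - g n)) \<le> inverse (real (Suc k))" for k
    using H[rule_format, of k] wnorm_nonneg[OF ell1_diff[OF HF(1) ell(1)], of k]
      wnorm_nonneg[OF ell1_diff[OF HF(2) ell(2)], of k] by simp_all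
  then have "(\<lambda>k. wnorm w (\<lambda>n. H k n - f n)) \<longlonglongrightarrow> 0" "(\<lambda>k. wnorm w (\<lambda>n. frag (H k) n - g n)) \<longlonglongrightarrow> 0"
    by (auto intro!: Lim_null_comparison[OF always_eventually LIMSEQ_inverse_real_of_nat])
  moreover have "(H k, frag (H k)) \<in> op_sum (op_A w a) (op_B w a b)" for k
    using H fin_supp_in_op_sum by blast
  ultimately show "(f, g) \<in> op_G w a b"
    unfolding op_G_def op_closure_def
    by (intro CollectI case_prodI conjI ell exI[of _ H] exI[of _ "\<lambda>k. frag (H k)"] allI)
qed

text \<open>A mean value inequality: the derivative of the displacement is
  \<open>semi s (frag h) - g\<close>. Testing against signs on finitely many coordinates reduces it
  to the scalar mean value theorem.\<close>

lemma semi_increment_bound: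
  assumes h: "fin_supp N h" and g: "g \<in> ell1 w" and t: "0 < t"
    and B: "\<And>s. 0 \<le> s \<Longrightarrow> s \<le> t \<Longrightarrow> wnorm w (\<lambda>n. semi s (frag h) n - g n) \<le> B"
  shows "wnorm w (\<lambda>n. semi t h n - h n - t * g n) \<le> t * B"
proof (rule ell1I_bounded_sums(2))
  note sol = semi_sol[OF h]
  define d where "d s = (\<lambda>n. semi s h n - h n - s * g n)" for s
  show "semi t h 0 - h 0 - t * g 0 = 0"
    using sol_fin_supp[OF sol, of t] h g by (simp add: fin_supp_def ell1_def)
  fix M
  \<comment> \<open>The signs are frozen at the final time, so \<open>\<phi>\<close> is
    differentiable in \<open>s\<close> and yet \<open>\<phi> t\<close> is a partial sum of the
    norm.\<close>
  define \<phi> where "\<phi> s = (\<Sum>n\<le>M. w n * (sgn (d t n) * d s n))" for s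
  define \<phi>' where "\<phi>' s = (\<Sum>n\<le>M. w n * (sgn (d t n) * (frag (semi s h) n - g n)))"
    for s
  have "(\<phi> has_real_derivative \<phi>' s) (at s)" for s
    unfolding \<phi>_def \<phi>'_def d_def
    by (intro DERIV_sum DERIV_cmult) (auto intro!: derivative_eq_intros sol_deriv[OF sol])
  from MVT2[OF t this] obtain z where z: "0 < z" "z < t" "\<phi> t - \<phi> 0 = (t - 0) * \<phi>' z"
    by blast
  have ell: "(\<lambda>n. frag (semi z h) n - g n) \<in> ell1 w"
    by (intro ell1_diff g fin_supp_ell1[OF fin_supp_frag[OF sol_fin_supp[OF sol]]])
  have "\<phi>' z \<le> (\<Sum>n\<le>M. w n * \<bar>frag (semi z h) n - g n\<bar>)"
    unfolding \<phi>'_def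
  proof (rule sum_mono)
    fix n
    show "w n * (sgn (d t n) * (frag (semi z h) n - g n)) \<le> w n * \<bar>frag (semi z h) n - g n\<bar>"
    proof (cases "n = 0")
      case True
      then show ?thesis using ell1_zero_index[OF ell] by simp
    next
      case False
      have "sgn (d t n) * x \<le> \<bar>x\<bar>" for x :: real by (auto simp: sgn_if)
      then show ?thesis using weight_pos[of n] False by (intro mult_left_mono) auto
    qed
  qed
  also have "\<dots> \<le> wnorm w (\<lambda>n. frag (semi z h) n - g n)"
    by (rule partial_sum_le_wnorm[OF ell]) simp
  also have "\<dots> \<le> B" using B[of z] z by (simp add: semi_frag[OF h])
  finally have "\<phi>' z \<le> B" .
  moreover have "\<phi> 0 = 0" by (simp add: \<phi>_def d_def semi_0_fin_supp[OF h])
  moreover have "\<phi> t = (\<Sum>n\<le>M. w n * \<bar>d t n\<bar>)"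
    unfolding \<phi>_def by (intro sum.cong refl) (simp add: abs_sgn mult.commute)
  ultimately show "(\<Sum>n\<le>M. w n * \<bar>semi t h n - h n - t * g n\<bar>) \<le> t * B"
    using z(3) t by (simp add: d_def)
qed

text \<open>The mean value bound handles a finitely supported \<open>h\<close> near
  \<open>f\<close>. Passing from \<open>h\<close> to \<open>f\<close> costs an error that gets
  divided by \<open>t\<close>; since \<open>h\<close> may be chosen after \<open>t\<close>, this
  error can be removed.\<close>

lemma core_limit_in_generator:
  assumes fg: "core_limit f g"
  shows "(f, g) \<in> generator w semi"
proof -
  have f: "f \<in> ell1 w" and g: "g \<in> ell1 w" using fg by (simp_all add: core_limit_def)
  have "((\<lambda>t. wnorm w (\<lambda>n. (semi t f n - f n) / t - g n)) \<longlongrightarrow> 0) (at_right 0)"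
  proof (rule tendstoI)
    fix e :: real assume e: "0 < e"
    have "\<forall>\<^sub>F t in at_right 0. wnorm w (\<lambda>n. semi t g n - g n) < e / 2"
      using e by (intro order_tendstoD(2)[OF C0_strong[OF semi_C0 g]]) simp
    then obtain \<delta> where \<delta>: "0 < \<delta>" "\<And>s. 0 < s \<Longrightarrow> s < \<delta> \<Longrightarrow> wnorm w (\<lambda>n. semi s g n - g n) < e / 2"
      unfolding eventually_at_right_field by blast
    have "wnorm w (\<lambda>n. (semi t f n - f n) / t - g n) \<le> e / 2" if t: "0 < t" "t < \<delta>"
      for t
    proof (rule field_le_epsilon)
      fix \<eta> :: real assume "0 < \<eta>"
      \<comment> \<open>Two \<open>\<epsilon>\<close> pay for exchanging \<open>f\<close> and
        \<open>h\<close> at the times 0 and \<open>t\<close>, and \<open>t * \<epsilon>\<close> pays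
        for exchanging \<open>frag h\<close> and \<open>g\<close>; together they make
        \<open>t * \<eta>\<close>.\<close>
      define \<epsilon> where "\<epsilon> = t * \<eta> / (2 + t)"
      have "0 < \<epsilon>" "(2 + t) * \<epsilon> = t * \<eta>" using \<open>0 < \<eta>\<close> t
        by (simp_all add: \<epsilon>_def)
      then have \<epsilon>: "0 < \<epsilon>" "2 * \<epsilon> + t * \<epsilon> = t * \<eta>"
        by (simp_all only: distrib_right)
      obtain N h where h: "fin_supp N h" and hf: "wnorm w (\<lambda>n. h n - f n) < \<epsilon>" and hg: "wnorm w (\<lambda>n. frag h n - g n) < \<epsilon>"
        using fg \<epsilon>(1) unfolding core_limit_def by blast
      note ell = f g fin_supp_ell1[OF h] fin_supp_ell1[OF fin_supp_frag[OF h]] semi_ell1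
      have "wnorm w (\<lambda>n. semi s (frag h) n - g n) \<le> \<epsilon> + e / 2"
        if s: "0 \<le> s" "s \<le> t" for s
      proof -
        have "wnorm w (\<lambda>n. semi s (frag h) n - g n)
            \<le> wnorm w (\<lambda>n. semi s (frag h) n - semi s g n) + wnorm w (\<lambda>n. semi s g n - g n)"
          by (intro wnorm_triangle ell s)
        also have "wnorm w (\<lambda>n. semi s (frag h) n - semi s g n) \<le> wnorm w (\<lambda>n. frag h n - g n)"
          unfolding bounded_op_diff[OF semi_bounded_op[OF s(1)] ell(4,2), symmetric]
          by (intro semi_contraction ell1_diff ell s)
        also have "wnorm w (\<lambda>n. semi s g n - g n) \<le> e / 2"
          using \<delta>(2)[of s] s t(2) e C0_zero[OF semi_C0 g] by (cases "s = 0") auto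
        finally show ?thesis using hg by simp
      qed
      then have "wnorm w (\<lambda>n. semi t h n - h n - t * g n) \<le> t * (\<epsilon> + e / 2)"
        by (intro semi_increment_bound[OF h g t(1)])
      moreover have "wnorm w (\<lambda>n. semi t f n - semi t h n) \<le> wnorm w (\<lambda>n. f n - h n)"
        unfolding bounded_op_diff[OF semi_bounded_op[OF less_imp_le[OF t(1)]] ell(1,3), symmetric]
        using t by (intro semi_contraction ell1_diff ell) auto
      moreover have "wnorm w (\<lambda>n. (semi t f n - semi t h n) + (semi t h n - h n - t * g n) + (h n - f n))
          \<le> wnorm w (\<lambda>n. semi t f n - semi t h n) + wnorm w (\<lambda>n. semi t h n - h n - t * g n)
            + wnorm w (\<lambda>n. h n - f n)"
      proof -
        have e1: "(\<lambda>n. semi t f n - semi t h n) \<in> ell1 w" "(\<lambda>n. semi t h n - h n - t * g n) \<in> ell1 w"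
            "(\<lambda>n. h n - f n) \<in> ell1 w"
          using t by (intro ell1_diff ell1_scale ell; simp)+
        show ?thesis using wnorm_add[OF ell1_add[OF e1(1,2)] e1(3)] wnorm_add[OF e1(1,2)] by simp
      qed
      ultimately have "wnorm w (\<lambda>n. semi t f n - f n - t * g n) \<le> t * (\<eta> + e / 2)"
        using hf \<epsilon>(2) by (simp add: wnorm_minus_commute[of f] algebra_simps)
      moreover have "t * wnorm w (\<lambda>n. (semi t f n - f n) / t - g n) = wnorm w (\<lambda>n. semi t f n - f n - t * g n)"
      proof -
        have "(\<lambda>n. (semi t f n - f n) / t - g n) = (\<lambda>n. (1/t) * (semi t f n - f n - t * g n))"
          using t by (simp add: field_simps)
        moreover have "(\<lambda>n. semi t f n - f n - t * g n) \<in> ell1 w"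
          using t by (intro ell1_diff ell1_scale ell) simp
        ultimately show ?thesis using wnorm_scale[of _ "1/t"] t by simp
      qed
      ultimately have "t * wnorm w (\<lambda>n. (semi t f n - f n) / t - g n) \<le> t * (\<eta> + e / 2)"
        by simp
      then show "wnorm w (\<lambda>n. (semi t f n - f n) / t - g n) \<le> e / 2 + \<eta>"
        using mult_le_cancel_left_pos[OF t(1)] by (simp add: add.commute)
    qed
    then have "dist (wnorm w (\<lambda>n. (semi t f n - f n) / t - g n)) 0 < e" if "0 < t" "t < \<delta>"
      for t
      using wnorm_nonneg[OF C0_quotient_ell1[OF semi_C0 that(1) f g]] e that
        by (fastforce simp: dist_real_def)
    then show "\<forall>\<^sub>F t in at_right 0. dist (wnorm w (\<lambda>n. (semi t f n - f n) / t - g n)) 0 < e"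
      unfolding eventually_at_right_field using \<delta>(1) by blast
  qed
  then show ?thesis using f g by (simp add: generator_def)
qed

text \<open>Back substitution in a triangular system whose diagonal entries
  \<open>1 - rate n n\<close> are positive, since losses are nonnegative.\<close>

lemma resolvent_fin_supp:
  assumes h: "fin_supp N h"
  shows "\<exists>x. fin_supp N x \<and> (\<forall>n. x n - frag x n = h n)"
proof -
  define Q where "Q n x \<longleftrightarrow> x n - rate n n * x n - (\<Sum>i\<in>{n<..N}. rate n i * x i) = h n" for n and x :: seq
  have diag: "0 < 1 - rate n n" for n using a_nonneg[of n] by (auto simp: rate_def)
  have "\<exists>x. (\<forall>n\<le>N. Q n x) \<and> (\<forall>n>N. x n = 0)"
  proof (rule downward_recursion)
    fix n and x :: seq
    define z where "z = (h n + (\<Sum>i\<in>{n<..N}. rate n i * x i)) / (1 - rate n n)"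
    have "(1 - rate n n) * z = h n + (\<Sum>i\<in>{n<..N}. rate n i * x i)"
      using diag[of n] by (simp add: z_def)
    then have "Q n (x(n := z))" by (simp add: Q_def left_diff_distrib)
    then show "\<exists>z. Q n (x(n := z))" by (rule exI[of _ z])
  next
    fix n and x y :: seq assume eq: "\<And>i. n \<le> i \<Longrightarrow> x i = y i" and "Q n x"
    have "(\<Sum>i\<in>{n<..N}. rate n i * x i) = (\<Sum>i\<in>{n<..N}. rate n i * y i)" using eq by simp
    with \<open>Q n x\<close> show "Q n y" using eq[of n] by (simp add: Q_def)
  qed
  then obtain x where x: "\<And>n. n \<le> N \<Longrightarrow> Q n x" "\<And>n. N < n \<Longrightarrow> x n = 0" by blast
  have "x 0 = 0" using x(1)[of 0] h by (simp add: Q_def rate_def fin_supp_def)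
  then have fin: "fin_supp N x" using x(2) by (simp add: fin_supp_def)
  have "x n - frag x n = h n" for n
  proof (cases "n \<le> N")
    case True
    then show ?thesis using x(1)[of n] by (simp add: Q_def frag_fin_supp_split[OF fin])
  next
    case False
    then show ?thesis using fin h fin_supp_frag[OF fin] by (simp add: fin_supp_def)
  qed
  then show ?thesis using fin by blast
qed

text \<open>Solve \<open>x - frag x = trunc N (f - g)\<close> on finitely supported sequences.
  Dissipativity bounds \<open>x - f\<close> by the truncation error of \<open>f - g\<close>, and
  then \<open>frag x - g\<close> by twice that error.\<close>

lemma generator_core_limit:
  assumes fg: "(f, g) \<in> generator w semi"
  shows "core_limit f g"
proof -
  note f = generator_ell1(1)[OF fg] and g = generator_ell1(2)[OF fg]
  have k: "(\<lambda>n. f n - g n) \<in> ell1 w" by (intro ell1_diff f g)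
  have "\<exists>N h. fin_supp N h \<and> wnorm w (\<lambda>n. h n - f n) < e \<and> wnorm w (\<lambda>n. frag h n - g n) < e"
    if e: "0 < e" for e
  proof -
    have "\<forall>\<^sub>F N in sequentially. wnorm w (\<lambda>n. trunc N (\<lambda>n. f n - g n) n - (f n - g n)) < e / 2"
      using e by (intro order_tendstoD(2)[OF trunc_tendsto[OF k]]) simp
    then obtain N where N: "wnorm w (\<lambda>n. trunc N (\<lambda>n. f n - g n) n - (f n - g n)) < e / 2"
      using eventually_happens'[OF sequentially_bot] by blast
    obtain x where x: "fin_supp N x" "\<And>n. x n - frag x n = trunc N (\<lambda>n. f n - g n) n"
      using resolvent_fin_supp[OF fin_supp_trunc[OF k]] by blast
    note ell = f g fin_supp_ell1[OF x(1)] fin_supp_ell1[OF fin_supp_frag[OF x(1)]]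
    have "(\<lambda>n. x n - f n, \<lambda>n. frag x n - g n) \<in> generator w semi"
      by (intro generator_diff[OF semi_C0] fg core_limit_in_generator core_limit_fin_supp[OF x(1)])
    then have "wnorm w (\<lambda>n. x n - f n) \<le> wnorm w (\<lambda>n. (x n - f n) - (frag x n - g n))"
      by (intro contraction_generator_dissipative[OF semi_C0] semi_contraction ell1_diff ell)
    also have "(\<lambda>n. (x n - f n) - (frag x n - g n)) = (\<lambda>n. trunc N (\<lambda>n. f n - g n) n - (f n - g n))"
      unfolding x(2)[symmetric] by (simp add: algebra_simps)
    finally have 1: "wnorm w (\<lambda>n. x n - f n) < e / 2" using N by simp
    have "(\<lambda>n. frag x n - g n) = (\<lambda>n. (x n - f n) - (trunc N (\<lambda>n. f n - g n) n - (f n - g n)))"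
      unfolding x(2)[symmetric] by (simp add: algebra_simps)
    moreover have "wnorm w (\<lambda>n. (x n - f n) - (trunc N (\<lambda>n. f n - g n) n - (f n - g n)))
        \<le> wnorm w (\<lambda>n. x n - f n) + wnorm w (\<lambda>n. trunc N (\<lambda>n. f n - g n) n - (f n - g n))"
      by (intro wnorm_diff ell1_diff ell fin_supp_ell1[OF fin_supp_trunc[OF k]] k)
    ultimately have "wnorm w (\<lambda>n. frag x n - g n) < e" using 1 N by simp
    moreover have "wnorm w (\<lambda>n. x n - f n) < e" using 1 e by simp
    ultimately show ?thesis using x(1) by blast
  qed
  then show ?thesis unfolding core_limit_def using f g by blast
qed

lemma generator_semi: "generator w semi = op_G w a b"
  using op_G_iff core_limit_in_generator generator_core_limit by (auto simp: set_eq_iff)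

text \<open>
  \<open>s \<mapsto> S (t - s) (semi s (basis j))\<close> is constant.  Expanding \<open>semi s (basis j)\<close> in the basis
  reduces this to the orbits of the basis vectors under \<open>S\<close>.
\<close>

lemma semi_unique:
  assumes S: "C0_semigroup w S" and gen: "generator w S = op_G w a b"
    and t: "0 \<le> t" and f: "f \<in> ell1 w"
  shows "S t f = semi t f"
proof (rule bounded_op_eqI[OF C0_bounded_op[OF S t] semi_bounded_op[OF t] _ f])
  fix j
  have basis_gen: "(basis k, frag (basis k)) \<in> generator w S" for k
    unfolding gen op_G_iff by (rule core_limit_fin_supp[OF fin_supp_basis[OF order_refl]])
  show "S t (basis j) = semi t (basis j)"
  proof
    fix n
    define z where "z k s = S s (basis k) n" for k s
    have z_deriv: "(z k has_real_derivative (\<Sum>i\<le>k. rate i k * z i s)) (at s within {0..})"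
      if "0 \<le> s" for k s
    proof -
      \<comment> \<open>Column \<open>k\<close> has only entries with index at most
        \<open>k\<close>, so the orbits of the first unit vectors satisfy a closed finite
        system.\<close>
      have "frag (basis k) = (\<lambda>n. \<Sum>i\<le>k. rate i k * basis i n)"
        using fin_supp_expand[OF fin_supp_frag[OF fin_supp_basis[of k k, OF order_refl]]]
        by (simp add: frag_basis fun_eq_iff)
      then have "S s (frag (basis k)) n = (\<Sum>i\<le>k. rate i k * z i s)"
        by (simp add: bounded_op_sum[OF C0_bounded_op[OF S that]] basis_ell1 z_def)
      then show ?thesis using C0_orbit_derivative[OF S basis_gen that, of k n]
        by (simp add: z_def[abs_def])
    qed
    define \<phi> where "\<phi> s = (\<Sum>k\<le>j. kern j s k * z k (t - s))" for s
    have "\<exists>c. \<forall>s\<in>{0..t}. \<phi> s = c"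
    proof (rule has_field_derivative_zero_constant)
      fix s assume s: "s \<in> {0..t}"
      have zt: "((\<lambda>s. z k (t - s)) has_real_derivative - (\<Sum>i\<le>k. rate i k * z i (t - s))) (at s within {0..t})" for k
      proof -
        have "(z k has_real_derivative (\<Sum>i\<le>k. rate i k * z i (t - s))) (at (t - s) within (\<lambda>s. t - s) ` {0..t})"
          by (rule has_field_derivative_subset[OF z_deriv]) (use s in auto)
        moreover have "((\<lambda>s. t - s) has_real_derivative - 1) (at s within {0..t})"
          by (auto intro!: derivative_eq_intros)
        ultimately have "(z k \<circ> (\<lambda>s. t - s) has_real_derivative (\<Sum>i\<le>k. rate i k * z i (t - s)) * - 1) (at s within {0..t})"
          by (rule DERIV_image_chain)
        then show ?thesis by (simp add: o_def)
      qed
      have kd: "((\<lambda>s. kern j s k) has_real_derivative frag (kern j s) k) (at s within {0..t})"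
        for k
        by (rule has_field_derivative_at_within[OF sol_deriv[OF sol_kern]])
      have "(\<phi> has_real_derivative (\<Sum>k\<le>j. frag (kern j s) k * z k (t - s)
          + - (\<Sum>i\<le>k. rate i k * z i (t - s)) * kern j s k)) (at s within {0..t})"
        unfolding \<phi>_def by (intro DERIV_sum DERIV_mult kd zt)
      moreover have "(\<Sum>k\<le>j. frag (kern j s) k * z k (t - s)) = (\<Sum>k\<le>j. \<Sum>i\<le>j. rate k i * kern j s i * z k (t - s))"
        by (simp add: frag_fin_supp[OF sol_fin_supp[OF sol_kern]] sum_distrib_right)
      moreover have "(\<Sum>k\<le>j. (\<Sum>i\<le>k. rate i k * z i (t - s)) * kern j s k)
          = (\<Sum>k\<le>j. \<Sum>i\<le>j. rate i k * kern j s k * z i (t - s))"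
      proof (rule sum.cong[OF refl])
        fix k assume "k \<in> {..j}"
        then have "(\<Sum>i\<le>k. rate i k * z i (t - s)) = (\<Sum>i\<le>j. rate i k * z i (t - s))"
          by (intro sum.mono_neutral_left) (auto simp: rate_def)
        then show "(\<Sum>i\<le>k. rate i k * z i (t - s)) * kern j s k = (\<Sum>i\<le>j. rate i k * kern j s k * z i (t - s))"
          by (simp only: sum_distrib_right) (simp only: mult_ac)
      qed
      \<comment> \<open>The forward derivative of the kernel and the backward derivative of the
        orbits cancel after the indices are exchanged.\<close>
      moreover have "(\<Sum>k\<le>j. \<Sum>i\<le>j. rate k i * kern j s i * z k (t - s))
          = (\<Sum>k\<le>j. \<Sum>i\<le>j. rate i k * kern j s k * z i (t - s))"
        by (rule sum.swap)
      ultimately show "(\<phi> has_real_derivative 0) (at s within {0..t})"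
        by (simp add: sum.distrib sum_negf sum_subtractf)
    qed simp
    then have "\<phi> 0 = \<phi> t" using t by auto
    moreover have "\<phi> 0 = S t (basis j) n"
    proof (cases "j = 0")
      case True
      have b0: "basis 0 = (\<lambda>n. 0)" by (auto simp: basis_def)
      have "S t (\<lambda>n. 0) = (\<lambda>n. 0)"
        using bounded_op_scale[OF C0_bounded_op[OF S t] ell1_zero, of 0] by simp
      then show ?thesis using True by (simp add: \<phi>_def kern_0 b0)
    next
      case False
      have "\<phi> 0 = (\<Sum>k\<le>j. basis j k * z k t)" by (simp add: \<phi>_def kern_0)
      then show ?thesis
        using False sum.remove[of "{..j}" j "\<lambda>k. basis j k * z k t"]
          by (simp add: basis_def[of j] z_def)
    qed
    moreover have "\<phi> t = semi t (basis j) n"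
    proof -
      have "\<phi> t = kern j t n"
        using fin_supp_expand[OF sol_fin_supp[OF sol_kern], of j t n]
        by (simp add: \<phi>_def z_def C0_zero[OF S basis_ell1])
      then show ?thesis
        using semi_eq_sol[OF fin_supp_basis[OF order_refl] sol_kern kern_0] by simp
    qed
    ultimately show "S t (basis j) n = semi t (basis j) n" by simp
  qed
qed

text \<open>\<open>semi\<close> shows that the choice has a candidate, and
  \<open>semi_unique\<close> identifies whichever candidate was chosen.\<close>

lemma frag_semigroup_eq_semi:
  assumes "0 \<le> t" "f \<in> ell1 w"
  shows "frag_semigroup w a b t f = semi t f"
proof -
  have "C0_semigroup w (frag_semigroup w a b) \<and> generator w (frag_semigroup w a b) = op_G w a b"
    unfolding frag_semigroup_def by (rule someI[of _ semi]) (simp add: semi_C0 generator_semi)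
  then show ?thesis using semi_unique assms by blast
qed

end

section \<open>Differentiation of monotone limits almost everywhere\<close>

lemma AE_lborel_not_in_negligible: "negligible N \<Longrightarrow> AE x in lborel. x \<notin> N"
  using AE_not_in[of N lebesgue] by (simp add: negligible_iff_null_sets AE_completion_iff)

lemma negligible_uminus:
  fixes N :: "real set"
  assumes "negligible N"
  shows "negligible (uminus ` N)"
  by (rule negligible_differentiable_image_negligible[OF order_refl assms])
    (auto intro!: derivative_intros simp: differentiable_on_def)

lemma AE_indefinite_integral_has_derivative:
  fixes G v :: "real \<Rightarrow> real"
  assumes G: "\<And>s t. 0 \<le> s \<Longrightarrow> s \<le> t \<Longrightarrow> (G has_integral v t - v s) {s..t}"
    and G0: "\<And>t. t < 0 \<Longrightarrow> G t = 0"
  shows "AE t in lborel. 0 \<le> t \<longrightarrow> (v has_real_derivative G t) (at t within {0..})"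
proof -
  \<comment> \<open>As \<open>G\<close> vanishes on negative arguments, only an interval starting at
    0 matters.\<close>
  have G_int: "G integrable_on cbox a b" for a b
  proof -
    have "(\<lambda>x. if x \<in> {0..max b 0} then G x else 0) integrable_on UNIV"
      unfolding integrable_restrict_UNIV using G[of 0 "max b 0"] by (auto simp: integrable_on_def)
    then have "(\<lambda>x. if x \<in> {0..max b 0} then G x else 0) integrable_on cbox a b"
      by (rule integrable_on_subcbox) simp
    then show ?thesis
      by (rule integrable_eq) (auto simp: G0)
  qed
  have Gm_int: "(\<lambda>x. G (- x)) integrable_on cbox a b" for a b
    using integrable_reflect[of G "- a" "- b"] G_int by simp
  obtain N1 where N1: "negligible N1"
      "\<And>x e. \<lbrakk>x \<notin> N1; 0 < e\<rbrakk> \<Longrightarrow> \<exists>d>0. \<forall>h. 0 < h \<and> h < d \<longrightarrow>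
          norm (integral (cbox x (x + h *\<^sub>R One)) G /\<^sub>R h ^ DIM(real) - G x) < e"
    using integrable_ccontinuous_explicit[OF G_int] by metis
  obtain N2 where N2: "negligible N2"
      "\<And>x e. \<lbrakk>x \<notin> N2; 0 < e\<rbrakk> \<Longrightarrow> \<exists>d>0. \<forall>h. 0 < h \<and> h < d \<longrightarrow>
          norm (integral (cbox x (x + h *\<^sub>R One)) (\<lambda>x. G (- x)) /\<^sub>R h ^ DIM(real) - G (- x)) < e"
    using integrable_ccontinuous_explicit[OF Gm_int] by metis
  have main: "(v has_real_derivative G t) (at t within {0..})"
    if t: "t \<notin> N1" "- t \<notin> N2" "0 \<le> t" for t
    unfolding has_field_derivative_iff
  proof (rule tendstoI)
    fix e :: real assume e: "0 < e"
    obtain d1 where d1: "0 < d1" "\<And>h. 0 < h \<Longrightarrow> h < d1 \<Longrightarrow> \<bar>integral {t..t + h} G / h - G t\<bar> < e"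
      using N1(2)[OF t(1) e] by (auto simp: divide_inverse_commute)
    obtain d2 where d2: "0 < d2" "\<And>h. 0 < h \<Longrightarrow> h < d2 \<Longrightarrow> \<bar>integral {- t..- t + h} (\<lambda>x. G (- x)) / h - G t\<bar> < e"
      using N2(2)[OF t(2) e] by (auto simp: divide_inverse_commute)
    have "dist ((v y - v t) / (y - t)) (G t) < e"
      if y: "0 \<le> y" "y \<noteq> t" "dist y t < min d1 d2" for y
    proof (cases "t < y")
      case True
      then show ?thesis
        using d1(2)[of "y - t"] integral_unique[OF G[OF \<open>0 \<le> t\<close>, of y]] y
          by (simp add: dist_real_def)
    next
      case False
      have "\<bar>(v t - v y) / (t - y) - G t\<bar> < e"
        using d2(2)[of "t - y"] integral_unique[OF G[OF y(1), of t]] y False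
        by (simp add: dist_real_def)
      moreover have "(v t - v y) / (t - y) = (v y - v t) / (y - t)"
        by (metis minus_diff_eq minus_divide_divide)
      ultimately show ?thesis by (simp add: dist_real_def)
    qed
    then show "\<forall>\<^sub>F y in at t within {0..}. dist ((v y - v t) / (y - t)) (G t) < e"
      unfolding eventually_at using d1(1) d2(1) by (intro exI[of _ "min d1 d2"]) auto
  qed
  have "AE t in lborel. t \<notin> N1" "AE t in lborel. t \<notin> uminus ` N2"
    by (intro AE_lborel_not_in_negligible N1 N2 negligible_uminus)+
  then show ?thesis
  proof eventually_elim
    case (elim t)
    then have "- t \<notin> N2" by (auto simp: image_iff)
    then show ?case using main elim by blast
  qed
qed

text \<open>
  Fubini's theorem on termwise differentiation of series of monotone functions, for continuously
  differentiable summands.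
\<close>

lemma AE_derivative_of_monotone_limit:
  fixes V g :: "nat \<Rightarrow> real \<Rightarrow> real"
  assumes deriv: "\<And>N t. (V N has_real_derivative g N t) (at t)"
    and meas: "\<And>N. g N \<in> borel_measurable borel"
    and nonneg: "\<And>N t. 0 \<le> t \<Longrightarrow> 0 \<le> g N t"
    and mono: "\<And>N t. 0 \<le> t \<Longrightarrow> g N t \<le> g (Suc N) t"
    and lim: "\<And>t. 0 \<le> t \<Longrightarrow> (\<lambda>N. V N t) \<longlonglongrightarrow> v t"
  shows "AE t in lborel. 0 \<le> t \<longrightarrow>
    (\<exists>L. (\<lambda>N. g N t) \<longlonglongrightarrow> L \<and> (v has_real_derivative L) (at t within {0..}))"
proof -
  have incseq: "incseq (\<lambda>N. g N t)" if "0 \<le> t" for t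
    using mono[OF that] by (rule incseq_SucI)
  have conv_upto: "AE t in lborel. t \<in> {0..T} \<longrightarrow> convergent (\<lambda>N. g N t)" if T: "0 \<le> T" for T
  proof -
    define F where "F N t = ennreal (g N t) * indicator {0..T} t" for N t
    have F_meas: "F N \<in> borel_measurable lborel" for N
      unfolding F_def using meas[of N] by simp
    have F_inc: "incseq F"
      by (intro incseq_SucI) (auto simp: F_def le_fun_def mono ennreal_leI split: split_indicator)
    have int: "(\<integral>\<^sup>+t. F N t \<partial>lborel) = ennreal (V N T - V N 0)" for N
      unfolding F_def by (rule nn_integral_FTC_Icc) (use meas deriv nonneg T in auto)
    obtain C where C: "\<And>N. V N T - V N 0 \<le> C"
    proof -
      have "Bseq (\<lambda>N. V N T - V N 0)"
        using tendsto_diff[OF lim[OF T] lim[OF order_refl]] by (intro convergent_imp_Bseq convergentI)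
      then obtain C where "\<forall>N. norm (V N T - V N 0) \<le> C" unfolding Bseq_def by blast
      then show ?thesis by (intro that[of C]) (simp add: abs_le_iff)
    qed
    \<comment> \<open>The increments of \<open>V N\<close> over \<open>[0, T]\<close> are bounded
      because they converge. Hence the supremum of the derivatives has finite integral and is finite
      almost everywhere.\<close>
    have "(\<integral>\<^sup>+t. (SUP N. F N t) \<partial>lborel) = (SUP N. \<integral>\<^sup>+t. F N t \<partial>lborel)"
      by (rule nn_integral_monotone_convergence_SUP[OF F_inc F_meas])
    also have "\<dots> \<le> ennreal C" unfolding int by (intro SUP_least ennreal_leI C)
    finally have "(\<integral>\<^sup>+t. (SUP N. F N t) \<partial>lborel) \<noteq> \<infinity>"
      using ennreal_less_top[of C] by (auto simp: top_unique)
    then have "AE t in lborel. (SUP N. F N t) \<noteq> \<infinity>"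
      by (intro nn_integral_PInf_AE borel_measurable_SUP F_meas) auto
    then show ?thesis
    proof eventually_elim
      case (elim t)
      show ?case
      proof
        assume t: "t \<in> {0..T}"
        define B where "B = (SUP N. F N t)"
        have "ennreal (g N t) \<le> B" for N
          using t SUP_upper[of N UNIV "\<lambda>N. F N t"] by (simp add: F_def B_def)
        moreover obtain r where "0 \<le> r" "B = ennreal r"
          using elim by (cases B) (auto simp: B_def)
        ultimately have le: "\<forall>N. g N t \<le> r" by simp
        have "incseq (\<lambda>N. g N t)" using incseq t by simp
        from incseq_convergent[OF this le] show "convergent (\<lambda>N. g N t)"
          by (auto intro: convergentI)
      qed
    qed
  qed
  have "AE t in lborel. \<forall>m::nat. t \<in> {0..real m} \<longrightarrow> convergent (\<lambda>N. g N t)"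
    unfolding AE_all_countable by (intro allI conv_upto) simp
  then have conv: "AE t in lborel. 0 \<le> t \<longrightarrow> convergent (\<lambda>N. g N t)"
  proof eventually_elim
    case (elim t)
    obtain m :: nat where "t \<le> real m" using real_arch_simple by blast
    then show ?case using elim by auto
  qed
  define Z where "Z = {t. 0 \<le> t \<and> \<not> convergent (\<lambda>N. g N t)}"
  have "AE t in lborel. t \<notin> Z" using conv by eventually_elim (auto simp: Z_def)
  then have Z: "negligible Z"
    unfolding negligible_iff_null_sets completion.null_sets_iff_AE
    by (simp add: AE_completion)
  define G where "G t = (if 0 \<le> t \<and> t \<notin> Z then lim (\<lambda>N. g N t) else 0)" for t
  have G_lim: "(\<lambda>N. g N t) \<longlonglongrightarrow> G t" if "0 \<le> t" "t \<notin> Z" for t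
    using that by (auto simp: G_def Z_def convergent_LIMSEQ_iff)
  \<comment> \<open>The convergence theorem asks for convergence at every point, so the integrands
    are set to 0 on the negligible set \<open>Z\<close>.\<close>
  have "(G has_integral v t - v s) {s..t}" if st: "0 \<le> s" "s \<le> t" for s t
  proof (rule has_integral_monotone_convergence_increasing)
    have "(g N has_integral V N t - V N s) {s..t}" for N
      by (rule fundamental_theorem_of_calculus[OF st(2)])
        (auto simp flip: has_real_derivative_iff_has_vector_derivative intro: has_field_derivative_at_within deriv)
    then show "((\<lambda>x. if x \<in> Z then 0 else g N x) has_integral V N t - V N s) {s..t}" for N
      by (rule has_integral_spike[OF Z, rotated]) simp
    show "(if x \<in> Z then 0 else g N x) \<le> (if x \<in> Z then 0 else g (Suc N) x)" if "x \<in> {s..t}"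
      for N x
      using mono that st by auto
    show "(\<lambda>N. if x \<in> Z then 0 else g N x) \<longlonglongrightarrow> G x" if "x \<in> {s..t}"
      for x
      using G_lim[of x] that st by (cases "x \<in> Z") (auto simp: G_def)
    show "(\<lambda>N. V N t - V N s) \<longlonglongrightarrow> v t - v s"
      using st by (intro tendsto_diff lim) auto
  qed
  then have "AE t in lborel. 0 \<le> t \<longrightarrow> (v has_real_derivative G t) (at t within {0..})"
    by (rule AE_indefinite_integral_has_derivative) (auto simp: G_def)
  with \<open>AE t in lborel. t \<notin> Z\<close> show ?thesis
    by eventually_elim (use G_lim in blast)
qed

section \<open>The differential equations\<close>

context frag_system
begin

text \<open>Stating the gain through \<open>sums\<close> keeps convergence and value together, so
  that two instances can be subtracted.\<close>

definition ode_at :: "seq \<Rightarrow> nat \<Rightarrow> real \<Rightarrow> bool" where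
  "ode_at f n t \<longleftrightarrow> (\<exists>L. (\<lambda>k. a (n + 1 + k) * b n (n + 1 + k) * semi t f (n + 1 + k)) sums L
     \<and> ((\<lambda>s. semi s f n) has_real_derivative - a n * semi t f n + L) (at t within {0..}))"

lemma ode_at_diff:
  assumes f: "f \<in> ell1 w" and g: "g \<in> ell1 w" and t: "0 \<le> t" and "ode_at f n t" "ode_at g n t"
  shows "ode_at (\<lambda>n. f n - g n) n t"
proof -
  have eq: "semi s (\<lambda>n. f n - g n) m = semi s f m - semi s g m" if "0 \<le> s" for s m
    using bounded_op_diff[OF semi_bounded_op[OF that] f g] by simp
  obtain L M where L: "(\<lambda>k. a (n + 1 + k) * b n (n + 1 + k) * semi t f (n + 1 + k)) sums L"
      "((\<lambda>s. semi s f n) has_real_derivative - a n * semi t f n + L) (at t within {0..})"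
    and M: "(\<lambda>k. a (n + 1 + k) * b n (n + 1 + k) * semi t g (n + 1 + k)) sums M"
      "((\<lambda>s. semi s g n) has_real_derivative - a n * semi t g n + M) (at t within {0..})"
    using assms(4,5) unfolding ode_at_def by blast
  have "(\<lambda>k. a (n + 1 + k) * b n (n + 1 + k) * semi t (\<lambda>n. f n - g n) (n + 1 + k)) sums (L - M)"
    using sums_diff[OF L(1) M(1)] by (simp add: eq[OF t] right_diff_distrib)
  moreover have "((\<lambda>s. semi s (\<lambda>n. f n - g n) n) has_real_derivative
      - a n * semi t (\<lambda>n. f n - g n) n + (L - M)) (at t within {0..})"
  proof (rule has_field_derivative_transform_within[OF _ zero_less_one])
    show "((\<lambda>s. semi s f n - semi s g n) has_real_derivative
        - a n * semi t (\<lambda>n. f n - g n) n + (L - M)) (at t within {0..})"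
      using DERIV_diff[OF L(2) M(2)] by (simp add: eq[OF t] algebra_simps)
  qed (use t eq in auto)
  ultimately show ?thesis unfolding ode_at_def by blast
qed

lemma semi_trunc: "semi t (trunc N f) i = (\<Sum>j\<le>N. f j * kern j t i)" if "f \<in> ell1 w"
  unfolding semi_fin_supp[OF fin_supp_trunc[OF that]] by (simp add: trunc_def)

lemma semi_trunc_tendsto:
  assumes "f \<in> ell1 w" "0 \<le> t"
  shows "(\<lambda>N. semi t (trunc N f) i) \<longlonglongrightarrow> semi t f i"
  unfolding semi_trunc[OF assms(1)] unfolding semi_def
    by (rule summable_LIMSEQ'[OF semi_summable[OF assms]])

lemma semi_nonneg:
  assumes "f \<in> ell1 w" "\<And>n. 0 \<le> f n" "0 \<le> t"
  shows "0 \<le> semi t f n"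
  unfolding semi_def
  by (intro suminf_nonneg semi_summable mult_nonneg_nonneg kern_nonneg assms)

text \<open>Differentiating the monotone limit yields a limit of truncated gain terms; it remains to
  identify it with the gain series of the limit itself and to undo the integrating factor.\<close>

lemma AE_ode_nonneg:
  assumes f: "f \<in> ell1 w" and f_nonneg: "\<And>n. 0 \<le> f n" and n: "1 \<le> n"
  shows "AE t in lborel. 0 \<le> t \<longrightarrow> ode_at f n t"
proof -
  define r where "r = rate n n"
  have r: "r = - a n" using n by (simp add: r_def rate_def)
  define x where "x N t = semi t (trunc N f)" for N t
  have x_eq: "x N t i = (\<Sum>j\<le>N. f j * kern j t i)" for N t i
    unfolding x_def by (rule semi_trunc[OF f])
  have x_sol: "sol N (x N)" for N
    unfolding x_def by (rule semi_sol[OF fin_supp_trunc[OF f]])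
  have x_nonneg: "0 \<le> x N t i" if "0 \<le> t" for N t i
    unfolding x_eq by (intro sum_nonneg mult_nonneg_nonneg f_nonneg kern_nonneg that)
  have x_mono: "x N t i \<le> x M t i" if "0 \<le> t" "N \<le> M" for N M t i
    unfolding x_eq by (intro sum_mono2) (use that in \<open>auto intro!: mult_nonneg_nonneg f_nonneg kern_nonneg\<close>)
  have x_lim: "(\<lambda>N. x N t i) \<longlonglongrightarrow> semi t f i" if "0 \<le> t" for t i
    unfolding x_def by (rule semi_trunc_tendsto[OF f that])
  \<comment> \<open>The gain term of the \<open>N\<close>-th truncated solution increases with
    \<open>N\<close> for two reasons: there are more summands, and each summand grows.\<close>
  define c where "c N t = (\<Sum>i\<in>{n<..N}. rate n i * x N t i)" for N t
  have rate_nonneg: "0 \<le> rate n i" if "i \<in> {n<..N}" for i N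
    using that by (intro rate_off_diagonal_nonneg) auto
  have "AE t in lborel. 0 \<le> t \<longrightarrow> (\<exists>L. (\<lambda>N. exp (- (r * t)) * c N t) \<longlonglongrightarrow> L
      \<and> ((\<lambda>t. exp (- (r * t)) * semi t f n) has_real_derivative L) (at t within {0..}))"
  proof (rule AE_derivative_of_monotone_limit)
    show "((\<lambda>t. exp (- (r * t)) * x N t n) has_real_derivative exp (- (r * t)) * c N t) (at t)"
      for N t
    proof (cases "n \<le> N")
      case True
      then show ?thesis unfolding r_def c_def by (rule sol_integrating_factor[OF x_sol])
    next
      case False
      then show ?thesis using sol_fin_supp[OF x_sol, of N] by (simp add: fin_supp_def c_def)
    qed
    have "isCont (\<lambda>t. x N t i) t" for N t i by (rule DERIV_isCont[OF sol_deriv[OF x_sol]])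
    then have "continuous_on UNIV (\<lambda>t. exp (- (r * t)) * c N t)" for N
      unfolding c_def by (intro continuous_at_imp_continuous_on ballI continuous_intros) auto
    then show "(\<lambda>t. exp (- (r * t)) * c N t) \<in> borel_measurable borel" for N
      by (rule borel_measurable_continuous_onI)
    fix N t assume t: "(0::real) \<le> t"
    show "0 \<le> exp (- (r * t)) * c N t"
      unfolding c_def by (intro mult_nonneg_nonneg sum_nonneg x_nonneg t rate_nonneg) auto
    have "c N t \<le> (\<Sum>i\<in>{n<..N}. rate n i * x (Suc N) t i)"
      unfolding c_def by (intro sum_mono mult_left_mono x_mono t rate_nonneg) auto
    also have "\<dots> \<le> c (Suc N) t"
      unfolding c_def by (rule sum_mono2) (auto intro!: mult_nonneg_nonneg x_nonneg t rate_off_diagonal_nonneg)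
    finally show "exp (- (r * t)) * c N t \<le> exp (- (r * t)) * c (Suc N) t" by simp
    show "(\<lambda>N. exp (- (r * t)) * x N t n) \<longlonglongrightarrow> exp (- (r * t)) * semi t f n"
      by (intro tendsto_intros x_lim t)
  qed
  then show ?thesis
  proof eventually_elim
    case (elim t)
    show ?case
    proof
      assume t: "0 \<le> t"
      then obtain L where L: "(\<lambda>N. exp (- (r * t)) * c N t) \<longlonglongrightarrow> L"
          "((\<lambda>t. exp (- (r * t)) * semi t f n) has_real_derivative L) (at t within {0..})"
        using elim by blast
      define D where "D = exp (r * t) * L"
      have "(\<lambda>N. exp (r * t) * (exp (- (r * t)) * c N t)) \<longlonglongrightarrow> D"
        unfolding D_def by (intro tendsto_mult tendsto_const L(1))
      then have c_lim: "(\<lambda>N. c N t) \<longlonglongrightarrow> D"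
        by (simp add: exp_minus field_simps)
      \<comment> \<open>These partial sums use the limit solution. They dominate
        \<open>c N t\<close>, and each is at most \<open>D\<close>: with \<open>M\<close> terms
        fixed, the truncated sums lie below \<open>c N t\<close> once \<open>N\<close> is at least
        \<open>M\<close>. So they also tend to \<open>D\<close>.\<close>
      define s where "s N = (\<Sum>i\<in>{n<..N}. rate n i * semi t f i)" for N
      have x_le: "x N t i \<le> semi t f i" for N i
        using x_mono[OF t] by (intro incseq_le[OF _ x_lim[OF t]]) (simp add: incseq_def)
      have c_le_s: "c N t \<le> s N" for N
        unfolding c_def s_def by (intro sum_mono mult_left_mono x_le rate_nonneg) auto
      have s_le: "s M \<le> D" for M
      proof (rule LIMSEQ_le)
        show "(\<lambda>N. \<Sum>i\<in>{n<..M}. rate n i * x N t i) \<longlonglongrightarrow> s M"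
          unfolding s_def by (intro tendsto_intros x_lim t)
        show "\<exists>N0. \<forall>N\<ge>N0. (\<Sum>i\<in>{n<..M}. rate n i * x N t i) \<le> c N t"
          unfolding c_def
          by (intro exI[of _ M] allI impI sum_mono2)
            (auto intro!: mult_nonneg_nonneg x_nonneg t rate_off_diagonal_nonneg)
      qed (rule c_lim)
      have s_lim: "s \<longlonglongrightarrow> D"
        by (rule tendsto_sandwich[OF _ _ c_lim tendsto_const]) (simp_all add: c_le_s s_le)
      have "(\<Sum>k<K. a (n + 1 + k) * b n (n + 1 + k) * semi t f (n + 1 + k)) = s (K + n)" for K
      proof (induction K)
        case (Suc K)
        have "{n<..Suc K + n} = insert (n + 1 + K) {n<..K + n}" by auto
        then show ?case using Suc n by (simp add: s_def rate_def)
      qed (simp add: s_def)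
      then have sums: "(\<lambda>k. a (n + 1 + k) * b n (n + 1 + k) * semi t f (n + 1 + k)) sums D"
        unfolding sums_def using LIMSEQ_ignore_initial_segment[OF s_lim, of n] by simp
      have "((\<lambda>t. exp (r * t)) has_real_derivative r * exp (r * t)) (at t within {0..})"
        by (auto intro!: derivative_eq_intros)
      from DERIV_mult[OF this L(2)]
      have "((\<lambda>s. semi s f n) has_real_derivative r * semi t f n + D) (at t within {0..})"
        by (simp add: D_def exp_minus field_simps)
      then show "ode_at f n t" unfolding ode_at_def r using sums by blast
    qed
  qed
qed

text \<open>Countably many equations allow one exceptional null set for all
  \<open>n\<close>.\<close>

lemma AE_ode:
  assumes f: "f \<in> ell1 w"
  shows "AE t in lborel. 0 \<le> t \<longrightarrow> (\<forall>n\<ge>1. ode_at f n t)"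
proof -
  define p where "p = (\<lambda>n. (\<bar>f n\<bar> + f n) / 2)"
  define q where "q = (\<lambda>n. (\<bar>f n\<bar> - f n) / 2)"
  have abs: "(\<lambda>n. \<bar>f n\<bar>) \<in> ell1 w" using f by (simp add: ell1_def)
  have p: "p \<in> ell1 w" using ell1_scale[OF ell1_add[OF abs f], of "1/2"] by (simp add: p_def)
  have q: "q \<in> ell1 w" using ell1_scale[OF ell1_diff[OF abs f], of "1/2"] by (simp add: q_def)
  have f_eq: "f = (\<lambda>n. p n - q n)" by (simp add: p_def q_def field_simps)
  have "AE t in lborel. \<forall>n. 1 \<le> n \<longrightarrow> 0 \<le> t \<longrightarrow> ode_at f n t"
    unfolding AE_all_countable
  proof
    fix n
    show "AE t in lborel. 1 \<le> n \<longrightarrow> 0 \<le> t \<longrightarrow> ode_at f n t"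
    proof (cases "1 \<le> n")
      case True
      have "AE t in lborel. 0 \<le> t \<longrightarrow> ode_at p n t" "AE t in lborel. 0 \<le> t \<longrightarrow> ode_at q n t"
        by (intro AE_ode_nonneg p q True; simp add: p_def q_def)+
      then show ?thesis
        by eventually_elim (use ode_at_diff[OF p q, folded f_eq] in blast)
    qed simp
  qed
  then show ?thesis by eventually_elim blast
qed

end

theorem theorem4p1:
  fixes a w u0 :: "nat \<Rightarrow> real" and b :: "nat \<Rightarrow> nat \<Rightarrow> real"
    and u :: "real \<Rightarrow> nat \<Rightarrow> real"
  assumes a_nonneg: "\<forall>n\<ge>1. 0 \<le> a n"
    and b_nonneg: "\<forall>n\<ge>1. \<forall>j\<ge>1. 0 \<le> b n j"
    and b_zero: "\<forall>n\<ge>1. \<forall>j\<ge>1. n \<ge> j \<longrightarrow> b n j = 0"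
    and w_pos: "\<forall>n\<ge>1. 0 < w n"
    and w_ge: "\<forall>n\<ge>1. real n \<le> w n"
    and kappa: "\<exists>\<kappa>. 0 < \<kappa> \<and> \<kappa> \<le> 1 \<and> (\<forall>j\<ge>2. (\<Sum>n\<in>{1..<j}. w n * b n j) \<le> \<kappa> * w j)"
    and u0: "u0 \<in> ell1 w"
    and u: "u = (\<lambda>t. frag_semigroup w a b t u0)"
  shows "(AE t in lborel. 0 \<le> t \<longrightarrow> (\<forall>n\<ge>1.
           summable (\<lambda>k. a (n + 1 + k) * b n (n + 1 + k) * u t (n + 1 + k)) \<and>
           ((\<lambda>s. u s n) has_real_derivative
              (- a n * u t n + (\<Sum>k. a (n + 1 + k) * b n (n + 1 + k) * u t (n + 1 + k))))
             (at t within {0..})))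
       \<and> (\<forall>n\<ge>1. u 0 n = u0 n)
       \<and> ((\<forall>n\<ge>1. 0 \<le> u0 n) \<longrightarrow> (\<forall>t\<ge>0. \<forall>n\<ge>1. 0 \<le> u t n))"
proof -
  interpret frag_system w a b
  proof
    fix j :: nat assume j: "2 \<le> j"
    from kappa obtain \<kappa> where \<kappa>: "\<kappa> \<le> 1" "(\<Sum>n\<in>{1..<j}. w n * b n j) \<le> \<kappa> * w j"
      using j by blast
    have "\<kappa> * w j \<le> 1 * w j" using \<kappa>(1) w_pos j
      by (intro mult_right_mono) (auto intro: less_imp_le)
    then show "(\<Sum>n\<in>{1..<j}. w n * b n j) \<le> w j" using \<kappa>(2) by simp
  qed (use a_nonneg b_nonneg w_pos in simp_all)
  have u_semi: "u t = semi t u0" if "0 \<le> t" for t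
    unfolding u by (rule frag_semigroup_eq_semi[OF that u0])
  have ode: "summable (\<lambda>k. a (n + 1 + k) * b n (n + 1 + k) * u t (n + 1 + k)) \<and>
      ((\<lambda>s. u s n) has_real_derivative
        (- a n * u t n + (\<Sum>k. a (n + 1 + k) * b n (n + 1 + k) * u t (n + 1 + k)))) (at t within {0..})"
    if t: "0 \<le> t" and ode_t: "ode_at u0 n t" for n t
  proof -
    obtain L where L: "(\<lambda>k. a (n + 1 + k) * b n (n + 1 + k) * u t (n + 1 + k)) sums L"
        "((\<lambda>s. semi s u0 n) has_real_derivative - a n * u t n + L) (at t within {0..})"
      using ode_t unfolding ode_at_def u_semi[OF t] by blast
    \<comment> \<open>\<open>u\<close> and \<open>semi\<close> are known to agree only at
      nonnegative times, so the derivative is transported within that half-line.\<close>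
    have "((\<lambda>s. u s n) has_real_derivative - a n * u t n + L) (at t within {0..})"
      by (rule has_field_derivative_transform_within[OF L(2) zero_less_one]) (use t u_semi in auto)
    then show ?thesis using L(1) by (auto simp: sums_iff)
  qed
  have equation: "AE t in lborel. 0 \<le> t \<longrightarrow> (\<forall>n\<ge>1.
      summable (\<lambda>k. a (n + 1 + k) * b n (n + 1 + k) * u t (n + 1 + k)) \<and>
      ((\<lambda>s. u s n) has_real_derivative
        (- a n * u t n + (\<Sum>k. a (n + 1 + k) * b n (n + 1 + k) * u t (n + 1 + k)))) (at t within {0..}))"
    using AE_ode[OF u0] by eventually_elim (use ode in blast)
  have initial: "u 0 = u0" using u_semi[of 0] C0_zero[OF semi_C0 u0] by simp
  have positive: "0 \<le> u t n" if "\<forall>n\<ge>1. 0 \<le> u0 n" "0 \<le> t" for t n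
  proof -
    have "0 \<le> u0 m" for m using that(1) ell1_zero_index[OF u0] by (cases "m = 0") auto
    then show ?thesis unfolding u_semi[OF that(2)] by (intro semi_nonneg u0 that(2))
  qed
  show ?thesis
    by (intro conjI equation allI impI positive) (simp_all add: initial)
qed

end
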